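(* (i) For any $M\ge0$, $\mu\in\mathrm{Sign}_M^+$, and $u\in\mathbb{C}$, $$F_\mu(u,qu,\dots,q^{M-1}u)=\frac{(q;q)_M}{(su;q)_M}\prod_{i=1}^M\left(\frac{q^{i-1}u-s}{1-sq^{i-1}u}\right)^{\mu_i}.$$ (ii) Fix $n\ge0$, $\nu\in\mathrm{Sign}_n^+$, and let $k\ge0$ be the number of coordinates of $\nu$ that are zero. Then for any $N\ge n-k$ and $v\in\mathbb{C}$, $$G_\nu(v,qv,\dots,q^{N-1}v)=\frac{(q;q)_N\,(s^2;q)_n\,(sv;q)_{N+k}}{(q;q)_{N-n+k}\,(s^2;q)_k\,(sv;q)_n\,(sv;q)_N\,(sv^{-1};q^{-1})_{n-k}}\prod_{i=1}^{n-k}\left(\frac{q^{i-1}v-s}{1-sq^{i-1}v}\right)^{\nu_i}.$$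
   Context: Throughout, $q,s$ are fixed generic complex parameters, and variables are such that no denominator vanishes. $(a;p)_n=\prod_{r=0}^{n-1}(1-ap^r)$ for $n\ge1$, $(a;p)_0=1$ (used with $p=q$ and $p=q^{-1}$). Signatures: a signature of length $L$ is a string of integers $\lambda=(\lambda_1\ge\dots\ge\lambda_L)$; $\mathrm{Sign}_L$ is the set of all of them, $\mathrm{Sign}_L^+$ those with nonnegative entries; $\mathrm{Sign}_0=\mathrm{Sign}_0^+=\{\varnothing\}$. Vertex weights: for $u\in\mathbb{C}$ and integers $m\ge 0$, $w_u(m,0;m,0)=\frac{1-sq^mu}{1-su}$, $w_u(m,1;m,1)=\frac{u-sq^m}{1-su}$, $w_u(m+1,0;m,1)=\frac{(1-s^2q^m)u}{1-su}$, $w_u(m,1;m+1,0)=\frac{1-q^{m+1}}{1-su}$, and $w_u(i_1,j_1;i_2,j_2)=0$ for all other nonnegative integers. Path weights: in the square grid, assign to each vertex $(i,j)$ the variable $u_j$ (constant along rows). A vertex is interior to an up-right path if it lies on the path and is not its beginning or ending vertex. The weight of a finite collection of up-right paths is the product, over all vertices interior to the paths of the collection, of $w_{u_j}(i_1,j_1;i_2,j_2)$, where $i_1,j_1,i_2,j_2$ are the numbers of paths of the collection containing the South, West, North, East edge at the vertex (weight $1$ if there are no interior vertices). Two collections are identified if they have the same interior vertices and the same numbers $(i_1,j_1,i_2,j_2)$ at each of them. $F$: for $\mu\in\mathrm{Sign}^+_M$, $F_\mu(u_1,\dots,u_M)$ is the sum of weights of all collections of $M$ up-right paths that start with the horizontal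 edges $(-1,j)\to(0,j)$, $1\le j\le M$, and end with the vertical edges $(\mu_l,M)\to(\mu_l,M+1)$, $1\le l\le M$. $G$: for $\nu\in\mathrm{Sign}_n^+$ and $N\ge 0$, $G_\nu(v_1,\dots,v_N)$ is the sum of weights (with variable $v_j$ assigned to row $j$) of all collections of $n$ up-right paths that all start with the vertical edge $(0,0)\to(0,1)$ (used $n$ times), and end with the vertical edges $(\nu_l,N)\to(\nu_l,N+1)$, $1\le l\le n$. *)

theory Defs
  imports Complex_Main "HOL-Library.Multiset"
begin

definition qpoch :: "complex \<Rightarrow> complex \<Rightarrow> nat \<Rightarrow> complex" where
  "qpoch a p n = (\<Prod>r<n. 1 - a * p ^ r)"

text \<open>The coordinate \<open>\<mu>\<^sub>i\<close> of a signature is the list entry \<open>\<mu> ! (i - 1)\<close>.\<close>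

definition Sign :: "nat \<Rightarrow> int list set" where
  "Sign L = {\<mu>. length \<mu> = L \<and> sorted_wrt (\<ge>) \<mu>}"

definition Sign_nonneg :: "nat \<Rightarrow> int list set" where
  "Sign_nonneg L = {\<mu> \<in> Sign L. \<forall>x \<in> set \<mu>. 0 \<le> x}"

text \<open>The arguments \<open>i1 j1 i2 j2\<close> are the numbers of paths through the South, West, North
  and East edge of a vertex.\<close>

definition vertex_weight ::
  "complex \<Rightarrow> complex \<Rightarrow> complex \<Rightarrow> nat \<Rightarrow> nat \<Rightarrow> nat \<Rightarrow> nat \<Rightarrow> complex" where
  "vertex_weight q s u i1 j1 i2 j2 =
     (if j1 = 0 \<and> j2 = 0 \<and> i2 = i1 then (1 - s * q ^ i1 * u) / (1 - s * u)
      else if j1 = 1 \<and> j2 = 1 \<and> i2 = i1 then (u - s * q ^ i1) / (1 - s * u)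
      else if j1 = 0 \<and> j2 = 1 \<and> i1 = i2 + 1 then (1 - s\<^sup>2 * q ^ i2) * u / (1 - s * u)
      else if j1 = 1 \<and> j2 = 0 \<and> i2 = i1 + 1 then (1 - q ^ (i1 + 1)) / (1 - s * u)
      else 0)"

type_synonym vertex = "int \<times> int"
type_synonym edge = "vertex \<times> vertex"

fun up_right_step :: "vertex \<Rightarrow> vertex \<Rightarrow> bool" where
  "up_right_step (a, b) (c, d) \<longleftrightarrow> (c = a + 1 \<and> d = b) \<or> (c = a \<and> d = b + 1)"

text \<open>A path is the list of its successive vertices; it has at least one edge.\<close>

definition up_right_path :: "vertex list \<Rightarrow> bool" where
  "up_right_path p \<longleftrightarrow> length p \<ge> 2 \<and> successively up_right_step p"

definition path_edges :: "vertex list \<Rightarrow> edge list" where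
  "path_edges p = zip p (tl p)"

definition first_edge :: "vertex list \<Rightarrow> edge" where
  "first_edge p = hd (path_edges p)"

definition last_edge :: "vertex list \<Rightarrow> edge" where
  "last_edge p = last (path_edges p)"

definition interior_vertices :: "vertex list \<Rightarrow> vertex set" where
  "interior_vertices p = set (butlast (tl p))"

text \<open>A collection of paths is a multiset of paths, and the prescribed starting and ending
  edges are multisets of edges: which starting edge is joined to which ending edge is not
  prescribed.\<close>

definition path_collections :: "edge multiset \<Rightarrow> edge multiset \<Rightarrow> vertex list multiset set" where
  "path_collections S T =
     {P. (\<forall>p \<in># P. up_right_path p) \<and> image_mset first_edge P = S \<and> image_mset last_edge P = T}"

definition edge_count :: "vertex list multiset \<Rightarrow> edge \<Rightarrow> nat" where
  "edge_count P e = size {#p \<in># P. e \<in> set (path_edges p)#}"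

fun vertex_numbers :: "vertex list multiset \<Rightarrow> vertex \<Rightarrow> nat \<times> nat \<times> nat \<times> nat" where
  "vertex_numbers P (i, j) =
     (edge_count P ((i, j - 1), (i, j)), edge_count P ((i - 1, j), (i, j)),
      edge_count P ((i, j), (i, j + 1)), edge_count P ((i, j), (i + 1, j)))"

text \<open>The configuration of a collection is the map from its interior vertices to the numbers
  \<open>(i1, j1, i2, j2)\<close> there; two collections are identified iff their configurations coincide.\<close>

definition configuration ::
  "vertex list multiset \<Rightarrow> vertex \<Rightarrow> (nat \<times> nat \<times> nat \<times> nat) option" where
  "configuration P x =
     (if \<exists>p \<in># P. x \<in> interior_vertices p then Some (vertex_numbers P x) else None)"

text \<open>The list \<open>us\<close> holds the variables of rows \<open>1, \<dots>, length us\<close>, so row \<open>j\<close> carries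
  \<open>us ! (j - 1)\<close>.\<close>

definition configuration_weight ::
  "complex \<Rightarrow> complex \<Rightarrow> complex list \<Rightarrow>
   (vertex \<Rightarrow> (nat \<times> nat \<times> nat \<times> nat) option) \<Rightarrow> complex" where
  "configuration_weight q s us c =
     (\<Prod>x \<in> dom c. case the (c x) of (i1, j1, i2, j2) \<Rightarrow>
        vertex_weight q s (us ! nat (snd x - 1)) i1 j1 i2 j2)"

text \<open>Every path lies in the rectangle spanned by its starting and ending edge, so the set of
  configurations is finite. Taking the image under \<^const>\<open>configuration\<close> counts
  identified collections once.\<close>

definition path_sum ::
  "complex \<Rightarrow> complex \<Rightarrow> complex list \<Rightarrow> edge multiset \<Rightarrow> edge multiset \<Rightarrow> complex" where
  "path_sum q s us S T =
     (\<Sum>c \<in> configuration ` path_collections S T. configuration_weight q s us c)"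

definition F :: "complex \<Rightarrow> complex \<Rightarrow> int list \<Rightarrow> complex list \<Rightarrow> complex" where
  "F q s \<mu> us =
     (let M = int (length us) in
      path_sum q s us
        (image_mset (\<lambda>j. ((-1, j), (0, j))) (mset_set {1..M}))
        (image_mset (\<lambda>m. ((m, M), (m, M + 1))) (mset \<mu>)))"

definition G :: "complex \<Rightarrow> complex \<Rightarrow> int list \<Rightarrow> complex list \<Rightarrow> complex" where
  "G q s \<nu> vs =
     (let N = int (length vs) in
      path_sum q s vs
        (replicate_mset (length \<nu>) ((0, 0), (0, 1)))
        (image_mset (\<lambda>m. ((m, N), (m, N + 1))) (mset \<nu>)))"

end

theory Submission
  imports Defs
begin

text \<open>
  The edges of a collection of paths form a multiset that satisfies a conservation law at every
  vertex, and conversely every such multiset decomposes into paths. The configurations are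
  therefore the integral flows with the prescribed boundary, and adding the top row last gives a
  recursion for their weighted sum. At most one path may use a horizontal edge, so the sum over one
  row is a product of \<open>2 \<times> 2\<close> transfer matrices, one per column. For the variables
  \<open>u, qu, q\<^sup>2u, \<dots>\<close> the claimed product over the parts of the signature is
  \<open>\<Prod>\<^sub>x A(h\<^sub>x)\<close> with \<open>A(h)\<close> the product of the first \<open>h\<close> ratios
  and \<open>h\<^sub>x\<close> the number of parts that are at least \<open>x\<close>; so it is local in the columns, and the
  row sum is evaluated by following an explicit vector through the columns from left to right.
\<close>

subsection \<open>Paths and flows\<close>

text \<open>Column 0 is the obstacle: the product over the parts only involves columns x \<ge> 1,
  and the coefficient in front of it depends on h_1 for \<open>G\<close>, though not for
  \<open>F\<close>. Since h_1 changes by the bit entering column 1, this coefficient can be absorbed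
  into the transfer matrix of column 0. All dependence on the boundary condition then sits in the
  two entries of the vector at column 1. The induction step from N - 1 to N rows amounts to checking
  that these are z * (1 - q^(N - h_1)) and z * q^(N - h_1) * (q^(h_1 - 1) * v - s) for a common z.
  Beyond the last part h = 0, so the row ends with the factor (1 - q^N) * z. For \<open>F\<close>, z
  is the previous coefficient divided by 1 - s * q^(N - 1) * u, and iterating gives (q;q)_M /
  (su;q)_M. For \<open>G\<close> the second entry forces one further factor of (s/v;1/q) into the
  denominator of z.\<close>

definition edge_mset :: "vertex list multiset \<Rightarrow> edge multiset" where
  "edge_mset P = (\<Sum>p\<in>#P. mset (path_edges p))"

lemma edge_mset_simps [simp]:
  "edge_mset {#} = {#}"
  "edge_mset (add_mset p P) = mset (path_edges p) + edge_mset P"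
  by (simp_all add: edge_mset_def)

lemma path_edges_simps [simp]:
  "path_edges [] = []" "path_edges [x] = []"
  "path_edges (x # y # p) = (x, y) # path_edges (y # p)"
  by (simp_all add: path_edges_def)

lemma up_right_pathD: "up_right_path p \<Longrightarrow> \<exists>x y r. p = x # y # r"
  by (cases p; cases "tl p") (auto simp: up_right_path_def)

lemma path_edges_nonempty: "e \<in> set (path_edges p) \<Longrightarrow> \<exists>x y r. p = x # y # r"
  by (cases p; cases "tl p") (auto simp: path_edges_def)

lemma up_right_step_le:
  "up_right_step x y \<Longrightarrow> fst x \<le> fst y \<and> snd x \<le> snd y \<and> fst y + snd y = fst x + snd x + 1"
  by (cases x; cases y) auto

text \<open>The proof detaches an edge with minimal tail \<open>x\<close> from \<open>E\<close>: no edge of \<open>E\<close> enters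
  \<open>x\<close>, so some path starts there, and moving its start along the edge gives a smaller flow.\<close>

lemma flow_decomposition:
  assumes "\<forall>e\<in>#E. up_right_step (fst e) (snd e)"
    and "image_mset snd E + A = image_mset fst E + B"
  shows "\<exists>P. (\<forall>p\<in>#P. p \<noteq> [] \<and> successively up_right_step p) \<and>
    image_mset hd P = A \<and> image_mset last P = B \<and> edge_mset P = E"
  using assms
proof (induction "size E" arbitrary: E A)
  case 0
  let ?P = "image_mset (\<lambda>x. [x]) A"
  have "edge_mset ?P = {#}"
    by (induction A) auto
  with 0 show ?case
    by (intro exI [of _ ?P]) (auto simp: image_mset.compositionality comp_def)
next
  case (Suc k)
  have ne: "E \<noteq> {#}" using Suc.hyps(2) by auto
  define g where "g = (\<lambda>e::edge. fst (fst e) + snd (fst e))"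
  obtain e where e: "e \<in># E" and emin: "\<And>e'. e' \<in># E \<Longrightarrow> g e \<le> g e'"
    using ne arg_min_if_finite [of "set_mset E" g]
    by (metis finite_set_mset leI set_mset_eq_empty_iff)
  obtain x y where xy: "e = (x, y)" by (cases e)
  have "x \<notin># image_mset snd E"
  proof
    assume "x \<in># image_mset snd E"
    then obtain e' where e': "e' \<in># E" "snd e' = x" by auto
    with Suc.prems(1) have "up_right_step (fst e') x" by auto
    from up_right_step_le [OF this] emin [OF e'(1)] show False
      by (simp add: g_def xy)
  qed
  moreover have "x \<in># image_mset fst E + B" using e xy by force
  ultimately have "x \<in># A" using Suc.prems(2)
    by (metis union_iff)
  then obtain A1 where A1: "A = add_mset x A1" by (metis multi_member_split)
  from e obtain E1 where E1: "E = add_mset e E1" by (metis multi_member_split)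
  have "image_mset snd E1 + add_mset y A1 = image_mset fst E1 + B"
    using Suc.prems(2) by (simp add: A1 E1 xy)
  moreover have "k = size E1" using Suc.hyps(2) by (simp add: E1)
  moreover have "\<forall>e\<in>#E1. up_right_step (fst e) (snd e)" using Suc.prems(1) by (simp add: E1)
  ultimately obtain P1 where P1: "\<forall>p\<in>#P1. p \<noteq> [] \<and> successively up_right_step p"
    "image_mset hd P1 = add_mset y A1" "image_mset last P1 = B" "edge_mset P1 = E1"
    using Suc.hyps(1) [of E1 "add_mset y A1"] by auto
  have "y \<in># image_mset hd P1" by (simp add: P1)
  then obtain p where p: "p \<in># P1" "hd p = y" by auto
  obtain P2 where P2: "P1 = add_mset p P2" using p(1) by (metis multi_member_split)
  obtain r where r: "p = y # r" using p P1(1) by (cases p) auto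
  have "up_right_step x y" using Suc.prems(1) e xy by auto
  then show ?case
    using P1 by (intro exI [of _ "add_mset (x # p) P2"]) (auto simp: P2 r E1 A1 xy)
qed

lemma edge_conservation:
  assumes "\<And>p. p \<in># P \<Longrightarrow> p \<noteq> []"
  shows "image_mset snd (edge_mset P) + image_mset hd P = image_mset fst (edge_mset P) + image_mset last P"
  using assms
proof (induction P)
  case (add p P)
  have "image_mset snd (mset (path_edges p)) + {#hd p#} = image_mset fst (mset (path_edges p)) + {#last p#}"
    if "p \<noteq> []" for p :: "vertex list"
    using that
  proof (induction p rule: induct_list012)
    case (3 x y p)
    then show ?case by (auto simp: ac_simps)
  qed auto
  from this [of p] add have "(image_mset snd (mset (path_edges p)) + {#hd p#}) +
      (image_mset snd (edge_mset P) + image_mset hd P) =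
      (image_mset fst (mset (path_edges p)) + {#last p#}) +
      (image_mset fst (edge_mset P) + image_mset last P)" by simp
  then show ?case by (simp add: ac_simps)
qed auto

lemma path_vertex_bounds:
  assumes "successively up_right_step p" "x \<in> set p"
  shows "fst (hd p) \<le> fst x \<and> snd (hd p) \<le> snd x \<and> fst x \<le> fst (last p) \<and> snd x \<le> snd (last p)"
  using assms
proof (induction p arbitrary: x rule: induct_list012)
  case (3 a b p)
  from 3(3) have ab: "up_right_step a b" and s: "successively up_right_step (b # p)" by auto
  note le = up_right_step_le [OF ab]
  show ?case
  proof (cases "x = a")
    case True
    with le 3(2) [OF s, of b] show ?thesis by auto
  next
    case False
    with le 3(2) [OF s, of x] 3(4) show ?thesis by auto
  qed
qed auto

lemma path_distinct:
  assumes "successively up_right_step p"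
  shows "distinct p"
  using assms
proof (induction p rule: induct_list012)
  case (3 a b p)
  from 3(3) have ab: "up_right_step a b" and s: "successively up_right_step (b # p)" by auto
  have "a \<notin> set (b # p)"
    using up_right_step_le [OF ab] path_vertex_bounds [OF s, of a] by auto
  with 3(2) s show ?case by auto
qed auto

lemma path_edges_distinct:
  assumes "successively up_right_step p"
  shows "distinct (path_edges p)"
  unfolding path_edges_def using path_distinct [OF assms] by (rule distinct_zipI1)

text \<open>\<open>edge_count\<close> counts paths, \<open>edge_mset\<close> counts traversals. They
  agree because an up-right path never returns to a vertex, so it traverses no edge twice.\<close>

lemma edge_count_edge_mset:
  assumes "\<forall>p\<in>#P. successively up_right_step p"
  shows "edge_count P e = count (edge_mset P) e"
  using assms
proof (induction P)
  case empty
  show ?case by (simp add: edge_count_def)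
next
  case (add p P)
  have "count (mset (path_edges p)) e = (if e \<in> set (path_edges p) then 1 else 0)"
    by (rule distinct_count_atmost_1 [THEN iffD1, rule_format])
      (use path_edges_distinct [of p] add.prems in auto)
  with add show ?case by (simp add: edge_count_def)
qed

lemma path_edge_step:
  assumes "successively up_right_step p" "e \<in> set (path_edges p)"
  shows "up_right_step (fst e) (snd e) \<and> fst e \<in> set (butlast p) \<and> snd e \<in> set (tl p)"
  using assms by (induction p rule: induct_list012) auto

text \<open>Bounds on the vertices alone would let a path climb in column -1 or run along row 0
  before it enters the rectangle. The first edge excludes this, since every later edge starts weakly
  beyond its end; the last edge acts likewise at the other side.\<close>

lemma path_edge_cases:
  assumes "successively up_right_step p" "e \<in> set (path_edges p)"
  shows "e = first_edge p \<or>
      fst (snd (first_edge p)) \<le> fst (fst e) \<and> snd (snd (first_edge p)) \<le> snd (fst e)"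
    and "e = last_edge p \<or>
      fst (snd e) \<le> fst (fst (last_edge p)) \<and> snd (snd e) \<le> snd (fst (last_edge p))"
proof -
  from path_edges_nonempty [OF assms(2)] obtain x y r where p: "p = x # y # r"
    by blast
  from assms(1) p have s: "successively up_right_step (y # r)" by auto
  show "e = first_edge p \<or>
      fst (snd (first_edge p)) \<le> fst (fst e) \<and> snd (snd (first_edge p)) \<le> snd (fst e)"
  proof (cases "e = (x, y)")
    case False
    with assms(2) p have "e \<in> set (path_edges (y # r))" by auto
    from path_edge_step [OF s this] have "fst e \<in> set (y # r)" by (blast dest: in_set_butlastD)
    from path_vertex_bounds [OF s this] show ?thesis by (simp add: first_edge_def p)
  qed (simp add: first_edge_def p)
  show "e = last_edge p \<or>
      fst (snd e) \<le> fst (fst (last_edge p)) \<and> snd (snd e) \<le> snd (fst (last_edge p))"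
    using assms
  proof (induction p rule: induct_list012)
    case (3 a b p)
    show ?case
    proof (cases "p = []")
      case True
      with 3 show ?thesis by (auto simp: last_edge_def)
    next
      case False
      then obtain c p' where pc: "p = c # p'" by (cases p) auto
      from 3(3) have ab: "up_right_step a b" and s: "successively up_right_step (b # p)" by auto
      have le: "last_edge (a # b # p) = last_edge (b # p)" by (simp add: last_edge_def pc)
      show ?thesis
      proof (cases "e = (a, b)")
        case True
        have "last_edge (b # p) \<in> set (path_edges (b # p))"
          unfolding last_edge_def by (rule last_in_set) (simp add: pc)
        from path_edge_step [OF s this] have "fst (last_edge (b # p)) \<in> set (b # p)"
          by (blast dest: in_set_butlastD)
        from path_vertex_bounds [OF s this] show ?thesis by (simp add: le True)
      next
        case False
        with 3 s le show ?thesis by auto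
      qed
    qed
  qed auto
qed

lemma first_last_edge:
  assumes "up_right_path p"
  shows "first_edge p \<in> set (path_edges p)" "last_edge p \<in> set (path_edges p)"
    "fst (first_edge p) = hd p" "snd (last_edge p) = last p"
proof -
  from up_right_pathD [OF assms] obtain x y r where p: "p = x # y # r"
    by blast
  have ne: "path_edges p \<noteq> []" by (simp add: p)
  show "first_edge p \<in> set (path_edges p)" "fst (first_edge p) = hd p"
    by (simp_all add: first_edge_def p)
  show "last_edge p \<in> set (path_edges p)"
    unfolding last_edge_def using ne by simp
  have "snd (last (path_edges (x # y # r))) = last (x # y # r)"
    by (induction r arbitrary: x y) auto
  then show "snd (last_edge p) = last p" by (simp add: last_edge_def p)
qed

lemma interior_vertices_iff:
  assumes "up_right_path p"
  shows "x \<in> interior_vertices p \<longleftrightarrow> x \<in> set p \<and> x \<noteq> hd p \<and> x \<noteq> last p"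
proof -
  from up_right_pathD [OF assms] obtain a b r where "p = a # b # r"
    by blast
  moreover obtain c z where "b # r = c @ [z]"
    by (metis list.distinct(1) rev_exhaust)
  ultimately have p: "p = a # c @ [z]" by simp
  have "distinct p" using assms path_distinct by (auto simp: up_right_path_def)
  then show ?thesis
    unfolding interior_vertices_def p by auto
qed

lemma path_vertex_edges:
  assumes "x \<in> set p"
  shows "(x = hd p \<or> x \<in> snd ` set (path_edges p)) \<and>
    (x = last p \<or> x \<in> fst ` set (path_edges p))"
  using assms by (induction p rule: induct_list012) auto

section \<open>Flows built row by row, and their characterization by conservation\<close>

definition vert :: "int \<Rightarrow> int multiset \<Rightarrow> edge multiset" where
  "vert j L = image_mset (\<lambda>i. ((i, j), (i, j + 1))) L"

text \<open>Horizontal edges are indexed by the column of their right end, so the paths entering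
  from the left contribute the column \<open>0\<close>.\<close>

definition hor :: "int \<Rightarrow> int multiset \<Rightarrow> edge multiset" where
  "hor j X = image_mset (\<lambda>i. ((i - 1, j), (i, j))) X"

text \<open>Conservation in one row: \<open>X\<close> are its horizontal edges, \<open>L\<close> and \<open>\<mu>\<close> the columns of the
  vertical edges below and above it, and \<open>b\<close> is the number of paths that start in the row, at
  column \<open>-1\<close> (\<open>b = 1\<close> for \<^const>\<open>F\<close>, \<open>b = 0\<close> for \<^const>\<open>G\<close>).\<close>

definition row_step :: "nat \<Rightarrow> nat \<Rightarrow> int multiset \<Rightarrow> int multiset \<Rightarrow> int multiset \<Rightarrow> bool" where
  "row_step K b \<mu> X L \<longleftrightarrow> set_mset X \<subseteq> {0..int K} \<and> set_mset L \<subseteq> {0..int K} \<and>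
     X + L + replicate_mset b (-1) = image_mset (\<lambda>i. i - 1) X + \<mu>"

text \<open>The vertical start edges of \<open>G\<close> are treated as the output of a row 0; for
  \<open>F\<close> this row is empty, with \<open>n = 0\<close>.\<close>

fun flows :: "nat \<Rightarrow> nat \<Rightarrow> nat \<Rightarrow> nat \<Rightarrow> int multiset \<Rightarrow> edge multiset set" where
  "flows K b n 0 \<mu> = (if \<mu> = replicate_mset n 0 then {vert 0 \<mu>} else {})"
| "flows K b n (Suc M) \<mu> =
     (\<lambda>((X, L), E). E + hor (int M + 1) X + vert (int M + 1) \<mu>) `
       (SIGMA y:{(X, L). row_step K b \<mu> X L}. flows K b n M (snd y))"

fun region :: "nat \<Rightarrow> nat \<Rightarrow> edge \<Rightarrow> bool" where
  "region K M ((a, b), (c, d)) \<longleftrightarrow>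
     c = a \<and> d = b + 1 \<and> 0 \<le> a \<and> a \<le> int K \<and> 0 \<le> b \<and> b \<le> int M \<or>
     d = b \<and> c = a + 1 \<and> -1 \<le> a \<and> a < int K \<and> 1 \<le> b \<and> b \<le> int M"

definition start_edges :: "nat \<Rightarrow> nat \<Rightarrow> nat \<Rightarrow> edge multiset" where
  "start_edges b n M = replicate_mset n ((0, 0), (0, 1)) +
     repeat_mset b (image_mset (\<lambda>j. ((-1, j), (0, j))) (mset_set {1..int M}))"

lemma image_mset_repeat_mset: "image_mset f (repeat_mset k A) = repeat_mset k (image_mset f A)"
  by (induction k) auto

lemma set_mset_repeat_mset_subset: "set_mset (repeat_mset k A) \<subseteq> set_mset A"
  by (induction k) auto

lemma fst_start_edges_Suc:
  "image_mset fst (start_edges b n (Suc M)) =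
   image_mset fst (start_edges b n M) + replicate_mset b (-1, int M + 1)"
proof -
  have "{1..int (Suc M)} = insert (int M + 1) {1..int M}" by auto
  then have "mset_set {1..int (Suc M)} = add_mset (int M + 1) (mset_set {1..int M})" by simp
  then show ?thesis
    by (simp add: start_edges_def repeat_mset_distrib_add_mset image_mset_repeat_mset
        del: of_nat_Suc)
qed

lemma start_edges_row:
  "e \<in># start_edges b n M \<Longrightarrow>
    e = ((0, 0), (0, 1)) \<or> (\<exists>j\<in>{1..int M}. e = ((-1, j), (0, j)))"
  using set_mset_repeat_mset_subset [of b "image_mset (\<lambda>j. ((-1, j), (0, j))) (mset_set {1..int M})"]
  by (auto simp: start_edges_def split: if_splits)

lemma count_image_row:
  "count (image_mset (\<lambda>i. (i, j)) L) (x, y) = (if y = j then count L x else 0)"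
  "count (image_mset (\<lambda>i. (i - 1, j)) L) (x, y) = (if y = j then count L (x + 1) else 0)"
  for x y j :: int
  by (induction L) auto

lemma count_image_pred: "count (image_mset (\<lambda>i. i - 1) L) x = count L (x + 1)" for x :: int
  by (induction L) auto

lemma image_vert_hor:
  "image_mset fst (vert j L) = image_mset (\<lambda>i. (i, j)) L"
  "image_mset snd (vert j L) = image_mset (\<lambda>i. (i, j + 1)) L"
  "image_mset fst (hor j L) = image_mset (\<lambda>i. (i - 1, j)) L"
  "image_mset snd (hor j L) = image_mset (\<lambda>i. (i, j)) L"
  by (simp_all add: vert_def hor_def image_mset.compositionality comp_def)

lemma flowsD:
  assumes "E \<in> flows K b n M \<mu>" "set_mset \<mu> \<subseteq> {0..int K}"
  shows "\<forall>e\<in>#E. region K M e"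
    and "image_mset snd E + image_mset fst (start_edges b n M) =
      image_mset fst E + image_mset (\<lambda>i. (i, int M + 1)) \<mu>"
  using assms
proof (induction M arbitrary: E \<mu>)
  case 0
  { case 1 then show ?case by (auto simp: vert_def split: if_splits) }
  { case 2
    then show ?case
      by (auto simp: image_vert_hor start_edges_def split: if_splits) }
next
  case (Suc M)
  { case 1
    then obtain X L E' where E: "E = E' + hor (int M + 1) X + vert (int M + 1) \<mu>"
      and st: "row_step K b \<mu> X L" and E': "E' \<in> flows K b n M L" by auto
    have L: "set_mset L \<subseteq> {0..int K}" and X: "set_mset X \<subseteq> {0..int K}"
      using st by (auto simp: row_step_def)
    have "region K (Suc M) e" if "region K M e" for e
      using that by (cases "(K, M, e)" rule: region.cases) auto
    with Suc.IH(1) [OF E' L] X 1(2) show ?case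
      by (auto simp: E vert_def hor_def) }
  { case 2
    then obtain X L E' where E: "E = E' + hor (int M + 1) X + vert (int M + 1) \<mu>"
      and st: "row_step K b \<mu> X L" and E': "E' \<in> flows K b n M L" by auto
    have L: "set_mset L \<subseteq> {0..int K}"
      using st by (auto simp: row_step_def)
    define f where "f = (\<lambda>i::int. (i, int M + 1))"
    have "image_mset f (X + L + replicate_mset b (-1)) = image_mset f (image_mset (\<lambda>i. i - 1) X + \<mu>)"
      using st by (simp add: row_step_def)
    then have "image_mset f X + image_mset f L + replicate_mset b (-1, int M + 1) =
       image_mset (\<lambda>i. (i - 1, int M + 1)) X + image_mset f \<mu>"
      by (simp add: f_def image_mset.compositionality comp_def)
    moreover note Suc.IH(2) [OF E' L]
    ultimately have "(image_mset f X + image_mset f L + replicate_mset b (-1, int M + 1)) +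
        (image_mset snd E' + image_mset fst (start_edges b n M)) =
        (image_mset (\<lambda>i. (i - 1, int M + 1)) X + image_mset f \<mu>) + (image_mset fst E' + image_mset f L)"
      by (simp add: f_def)
    then show ?case
      by (simp add: E fst_start_edges_Suc image_vert_hor f_def ac_simps) }
qed

text \<open>The top row is peeled off: \<open>X\<close> and \<open>L\<close> are its horizontal and
  its upward edges, and \<open>L'\<close> records where the remaining edges enter it. The
  conservation law is then compared level by level: above the row it gives \<open>L = \<mu>\<close>,
  in the row it gives \<open>row_step\<close>, and below it becomes the hypothesis of the
  induction.\<close>

lemma flowsI:
  assumes "\<forall>e\<in>#E. region K M e" "set_mset \<mu> \<subseteq> {0..int K}"
    and "image_mset snd E + image_mset fst (start_edges b n M) =
      image_mset fst E + image_mset (\<lambda>i. (i, int M + 1)) \<mu>"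
  shows "E \<in> flows K b n M \<mu>"
  using assms
proof (induction M arbitrary: E \<mu>)
  case 0
  define L where "L = image_mset (\<lambda>e. fst (fst e)) E"
  have "\<forall>e\<in>#E. region K 0 e \<Longrightarrow> E = vert 0 (image_mset (\<lambda>e. fst (fst e)) E)" for E
    by (induction E) (auto simp: vert_def)
  then have E: "E = vert 0 L" using 0(1) unfolding L_def by blast
  have eq: "image_mset (\<lambda>i. (i, 1)) L + image_mset (\<lambda>i. (i, 0)) (replicate_mset n 0) =
      image_mset (\<lambda>i. (i, 0::int)) L + image_mset (\<lambda>i. (i, 1)) \<mu>"
    using 0(3) by (simp add: E image_vert_hor start_edges_def)
  have "count L i = count \<mu> i" for i
    using arg_cong [OF eq, of "\<lambda>S. count S (i, 1)"] by (simp only: count_union count_image_row) simp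
  moreover have "count (replicate_mset n 0) i = count L i" for i
    using arg_cong [OF eq, of "\<lambda>S. count S (i, 0)"] by (simp only: count_union count_image_row) simp
  ultimately have "L = \<mu>" "\<mu> = replicate_mset n 0" by (auto intro!: multiset_eqI)
  then show ?case by (simp add: E)
next
  case (Suc M)
  let ?r = "int M + 1"
  define E' where "E' = {#e \<in># E. snd (fst e) \<noteq> ?r#}"
  define X where "X = image_mset (\<lambda>e. fst (snd e)) {#e \<in># E. snd (fst e) = ?r \<and> snd (snd e) = ?r#}"
  define L where "L = image_mset (\<lambda>e. fst (fst e)) {#e \<in># E. snd (fst e) = ?r \<and> snd (snd e) \<noteq> ?r#}"
  define L' where "L' = image_mset (\<lambda>e. fst (snd e)) {#e \<in># E'. snd (snd e) = ?r#}"
  have "\<forall>e\<in>#E. region K (Suc M) e \<Longrightarrow> E =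
    {#e \<in># E. snd (fst e) \<noteq> ?r#} +
    hor ?r (image_mset (\<lambda>e. fst (snd e)) {#e \<in># E. snd (fst e) = ?r \<and> snd (snd e) = ?r#}) +
    vert ?r (image_mset (\<lambda>e. fst (fst e)) {#e \<in># E. snd (fst e) = ?r \<and> snd (snd e) \<noteq> ?r#})" for E
    by (induction E) (auto simp: vert_def hor_def)
  then have E: "E = E' + hor ?r X + vert ?r L"
    using Suc.prems(1) unfolding E'_def L_def X_def by blast
  have reg: "region K (Suc M) e" if "e \<in># E" for e using Suc.prems(1) that by blast
  have reg': "region K M e" if "e \<in># E'" for e
    using reg [of e] that by (cases "(K, M, e)" rule: region.cases) (auto simp: E'_def)
  have X: "set_mset X \<subseteq> {0..int K}"
    using reg by (force simp: X_def)
  have L': "set_mset L' \<subseteq> {0..int K}"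
    using reg' by (force simp: L'_def)
  have eq: "image_mset snd E' + image_mset (\<lambda>i. (i, ?r)) X + image_mset (\<lambda>i. (i, ?r + 1)) L +
      (image_mset fst (start_edges b n M) + image_mset (\<lambda>i. (i, ?r)) (replicate_mset b (-1))) =
      image_mset fst E' + image_mset (\<lambda>i. (i - 1, ?r)) X + image_mset (\<lambda>i. (i, ?r)) L +
      image_mset (\<lambda>i. (i, ?r + 1)) \<mu>"
    using Suc.prems(3) by (simp add: E image_vert_hor fst_start_edges_Suc)
  have z1: "count (image_mset snd E') (x, y) = 0" if "y > ?r" for x y
    using reg' that by (force simp: count_eq_zero_iff)
  have "count (image_mset snd E) (x, y) = count (image_mset (\<lambda>e. fst (snd e)) {#e \<in># E. snd (snd e) = y#}) x"
    for E :: "edge multiset" and x y by (induction E) auto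
  then have z2: "count (image_mset snd E') (x, ?r) = count L' x" for x
    unfolding L'_def by blast
  have z3: "count (image_mset fst E') (x, y) = 0" if "y \<ge> ?r" for x y
    using reg' that by (force simp: count_eq_zero_iff)
  have z4: "count (image_mset fst (start_edges b n M)) (x, y) = 0" if "y \<ge> ?r" for x y
    using that by (auto simp: count_eq_zero_iff dest!: start_edges_row)
  note cnt = count_union count_image_row
  have L: "L = \<mu>"
  proof (rule multiset_eqI)
    fix i show "count L i = count \<mu> i"
      using arg_cong [OF eq, of "\<lambda>S. count S (i, ?r + 1)"]
      by (simp only: cnt) (simp add: z1 z3 z4)
  qed
  have "X + L' + replicate_mset b (-1) = image_mset (\<lambda>i. i - 1) X + \<mu>"
  proof (rule multiset_eqI)
    fix i show "count (X + L' + replicate_mset b (-1)) i = count (image_mset (\<lambda>i. i - 1) X + \<mu>) i"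
      using arg_cong [OF eq, of "\<lambda>S. count S (i, ?r)"]
      by (simp only: cnt count_image_pred) (simp add: z2 z3 z4 L)
  qed
  then have st: "row_step K b \<mu> X L'" using X L' by (simp add: row_step_def)
  have "image_mset snd E' + image_mset fst (start_edges b n M) =
      image_mset fst E' + image_mset (\<lambda>i. (i, ?r)) L'"
  proof (rule multiset_eqI)
    fix v :: vertex
    obtain x y where v: "v = (x, y)" by (cases v)
    show "count (image_mset snd E' + image_mset fst (start_edges b n M)) v =
      count (image_mset fst E' + image_mset (\<lambda>i. (i, ?r)) L') v"
    proof (cases "y \<ge> ?r")
      case True
      then show ?thesis
        unfolding v by (cases "y = ?r") (simp_all only: cnt z1 z2 z3 z4, simp_all add: z1)
    next
      case False
      then show ?thesis
        using arg_cong [OF eq, of "\<lambda>S. count S (x, y)"]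
        unfolding v by (simp only: cnt) simp
    qed
  qed
  then have "E' \<in> flows K b n M L'"
    using Suc.IH reg' L' by blast
  with st show ?case
    by (auto simp: E L image_iff intro!: bexI [of _ "((X, L'), E')"])
qed

fun local_numbers :: "edge multiset \<Rightarrow> vertex \<Rightarrow> nat \<times> nat \<times> nat \<times> nat" where
  "local_numbers E (i, j) =
     (count E ((i, j - 1), (i, j)), count E ((i - 1, j), (i, j)),
      count E ((i, j), (i, j + 1)), count E ((i, j), (i + 1, j)))"

section \<open>Configurations of collections correspond to flows\<close>

definition flow_config ::
  "nat \<Rightarrow> nat \<Rightarrow> edge multiset \<Rightarrow> vertex \<Rightarrow> (nat \<times> nat \<times> nat \<times> nat) option" where
  "flow_config K M E x =
     (if x \<in> {0..int K} \<times> {1..int M} \<and> local_numbers E x \<noteq> (0, 0, 0, 0)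
      then Some (local_numbers E x) else None)"

definition flow_weight ::
  "complex \<Rightarrow> complex \<Rightarrow> nat \<Rightarrow> complex list \<Rightarrow> edge multiset \<Rightarrow> complex" where
  "flow_weight q s K us E = (\<Prod>j<length us. \<Prod>i\<le>K.
     case local_numbers E (int i, int j + 1) of (i1, j1, i2, j2) \<Rightarrow>
       vertex_weight q s (us ! j) i1 j1 i2 j2)"

abbreviation collections :: "nat \<Rightarrow> nat \<Rightarrow> nat \<Rightarrow> int multiset \<Rightarrow> vertex list multiset set" where
  "collections b n M \<mu> \<equiv> path_collections (start_edges b n M) (vert (int M) \<mu>)"

lemma in_edge_mset_iff: "e \<in># edge_mset P \<longleftrightarrow> (\<exists>p\<in>#P. e \<in> set (path_edges p))"
  by (induction P) auto

lemma collectionsD: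
  assumes "P \<in> collections b n M \<mu>" "p \<in># P"
  shows "up_right_path p" "first_edge p \<in># start_edges b n M" "last_edge p \<in># vert (int M) \<mu>"
  using assms by (auto simp: path_collections_def) (metis imageI set_image_mset)+

lemma collections_region:
  assumes P: "P \<in> collections b n M \<mu>" and \<mu>: "set_mset \<mu> \<subseteq> {0..int K}"
    and p: "p \<in># P" and e: "e \<in> set (path_edges p)"
  shows "region K M e"
proof -
  have up: "up_right_path p" and f: "first_edge p \<in># start_edges b n M"
    and l: "last_edge p \<in># vert (int M) \<mu>"
    using collectionsD [OF P p] by auto
  then have s: "successively up_right_step p" by (simp add: up_right_path_def)
  obtain m where m: "last_edge p = ((m, int M), (m, int M + 1))" "0 \<le> m" "m \<le> int K"
    using l \<mu> by (auto simp: vert_def)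
  obtain x1 y1 x2 y2 where e4: "e = ((x1, y1), (x2, y2))" by (metis surj_pair)
  have st: "up_right_step (x1, y1) (x2, y2)" using path_edge_step [OF s e] e4 by auto
  note c = path_edge_cases [OF s e]
  have F: "fst (snd (first_edge p)) = 0" "1 \<le> snd (snd (first_edge p))"
    using start_edges_row [OF f] by auto
  show ?thesis
  proof (cases "e = first_edge p")
    case True
    with start_edges_row [OF f] show ?thesis by auto
  next
    case first: False
    with c(1) F have ge: "0 \<le> x1" "1 \<le> y1" by (auto simp: e4)
    show ?thesis
    proof (cases "e = last_edge p")
      case True
      with m show ?thesis by simp
    next
      case False
      with c(2) m have "x2 \<le> int K" "y2 \<le> int M" by (auto simp: e4)
      with st ge show ?thesis by (auto simp: e4)
    qed
  qed
qed

text \<open>All paths start in column -1 or row 0 and end in row \<open>M + 1\<close>, hence outside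
  the rectangle of the vertices that carry weights. A vertex of the rectangle is therefore interior
  to every path that visits it, and being interior to some path just means that its numbers are not
  all zero.\<close>

lemma collections_flow:
  assumes P: "P \<in> collections b n M \<mu>" and \<mu>: "set_mset \<mu> \<subseteq> {0..int K}"
  shows "edge_mset P \<in> flows K b n M \<mu>" "configuration P = flow_config K M (edge_mset P)"
proof -
  let ?E = "edge_mset P"
  have s: "\<forall>p\<in>#P. successively up_right_step p" and ne: "\<And>p. p \<in># P \<Longrightarrow> p \<noteq> []"
    using collectionsD(1) [OF P] by (fastforce simp: up_right_path_def)+
  have reg: "\<forall>e\<in>#?E. region K M e"
    using collections_region [OF P \<mu>] in_edge_mset_iff by blast
  have "image_mset hd P = image_mset fst (image_mset first_edge P)"
    unfolding image_mset.compositionality comp_def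
    by (rule image_mset_cong) (use collectionsD(1) [OF P] first_last_edge(3) in auto)
  also have "image_mset first_edge P = start_edges b n M"
    using P by (simp add: path_collections_def)
  finally have hd: "image_mset hd P = image_mset fst (start_edges b n M)" .
  have "image_mset last P = image_mset snd (image_mset last_edge P)"
    unfolding image_mset.compositionality comp_def
    by (rule image_mset_cong) (use collectionsD(1) [OF P] first_last_edge(4) in auto)
  also have "image_mset last_edge P = vert (int M) \<mu>"
    using P by (simp add: path_collections_def)
  finally have last: "image_mset last P = image_mset (\<lambda>i. (i, int M + 1)) \<mu>"
    by (simp add: image_vert_hor)
  show "?E \<in> flows K b n M \<mu>"
    using edge_conservation [of P, OF ne] reg \<mu> by (intro flowsI) (auto simp: hd last)
  show "configuration P = flow_config K M ?E"
  proof
    fix x :: vertex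
    obtain i j where x: "x = (i, j)" by (cases x)
    have nums: "vertex_numbers P x = local_numbers ?E x"
      by (simp add: x edge_count_edge_mset [OF s])
    have "(\<exists>p\<in>#P. x \<in> interior_vertices p) \<longleftrightarrow>
      x \<in> {0..int K} \<times> {1..int M} \<and> local_numbers ?E x \<noteq> (0, 0, 0, 0)" (is "?l \<longleftrightarrow> ?r")
    proof
      assume ?l
      then obtain p where p: "p \<in># P" and int: "x \<in> interior_vertices p" by blast
      have up: "up_right_path p" using collectionsD(1) [OF P p] .
      from int have "x \<in> set p" "x \<noteq> hd p" "x \<noteq> last p" by (auto simp: interior_vertices_iff [OF up])
      with path_vertex_edges [of x p] obtain y z where
        yz: "(y, x) \<in> set (path_edges p)" "(x, z) \<in> set (path_edges p)" by auto
      then have E: "(y, x) \<in># ?E" "(x, z) \<in># ?E" using p by (auto simp: in_edge_mset_iff)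
      then have r: "region K M (y, x)" "region K M (x, z)" using reg by auto
      have "x \<in> {0..int K} \<times> {1..int M}"
        using r by (cases y; cases z) (auto simp: x)
      moreover have "z = (i, j + 1) \<or> z = (i + 1, j)"
        using r(2) by (cases z) (auto simp: x)
      then have "local_numbers ?E x \<noteq> (0, 0, 0, 0)"
        using E(2) by (auto simp: x)
      ultimately show ?r by blast
    next
      assume r: ?r
      then have "((i, j - 1), (i, j)) \<in># ?E \<or> ((i - 1, j), (i, j)) \<in># ?E \<or>
          ((i, j), (i, j + 1)) \<in># ?E \<or> ((i, j), (i + 1, j)) \<in># ?E"
        by (auto simp: x not_in_iff)
      then have "\<exists>e\<in>#?E. fst e = x \<or> snd e = x"
        unfolding x by (elim disjE; force)
      then obtain p e where p: "p \<in># P" and e: "e \<in> set (path_edges p)" "fst e = x \<or> snd e = x"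
        by (auto simp: in_edge_mset_iff)
      have up: "up_right_path p" using collectionsD(1) [OF P p] .
      have "fst e \<in> set (butlast p) \<and> snd e \<in> set (tl p)"
        using path_edge_step s p e(1) by blast
      then have "x \<in> set p" using e(2) ne [OF p] by (metis in_set_butlastD list.set_sel(2))
      moreover have "x \<noteq> hd p"
        using r start_edges_row [OF collectionsD(2) [OF P p]] first_last_edge(3) [OF up]
        by (auto simp del: local_numbers.simps dest: sym)
      moreover have "x \<noteq> last p"
        using r collectionsD(3) [OF P p] first_last_edge(4) [OF up]
        by (auto simp: vert_def simp del: local_numbers.simps dest: sym)
      ultimately show ?l using p interior_vertices_iff [OF up] by blast
    qed
    then show "configuration P x = flow_config K M ?E x"
      by (simp add: configuration_def flow_config_def nums)
  qed
qed

text \<open>The decomposition only controls the end vertices of the paths, while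
  \<open>path_collections\<close> prescribes end edges. The latter follow because
  \<open>region\<close> leaves a single way out of each start vertex and a single way into each end
  vertex.\<close>

lemma flow_collection:
  assumes E: "E \<in> flows K b n M \<mu>" and \<mu>: "set_mset \<mu> \<subseteq> {0..int K}"
  shows "\<exists>P\<in>collections b n M \<mu>. edge_mset P = E"
proof -
  have reg: "\<forall>e\<in>#E. region K M e" using flowsD(1) [OF E \<mu>] .
  have "up_right_step (fst e) (snd e)" if "region K M e" for e
    using that by (cases "(K, M, e)" rule: region.cases) auto
  with reg have "\<forall>e\<in>#E. up_right_step (fst e) (snd e)" by blast
  from flow_decomposition [OF this flowsD(2) [OF E \<mu>]]
  obtain P where P: "\<forall>p\<in>#P. p \<noteq> [] \<and> successively up_right_step p"
    "image_mset hd P = image_mset fst (start_edges b n M)"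
    "image_mset last P = image_mset (\<lambda>i. (i, int M + 1)) \<mu>" "edge_mset P = E" by auto
  have hd: "hd p = (0, 0) \<or> (\<exists>j\<in>{1..int M}. hd p = (-1, j))" if p: "p \<in># P" for p
  proof -
    have "hd p \<in># image_mset fst (start_edges b n M)" unfolding P(2) [symmetric] using p by auto
    then show ?thesis by (auto dest!: start_edges_row)
  qed
  have last: "\<exists>i. last p = (i, int M + 1)" if p: "p \<in># P" for p
  proof -
    have "last p \<in># image_mset (\<lambda>i. (i, int M + 1)) \<mu>" unfolding P(3) [symmetric] using p by auto
    then show ?thesis by auto
  qed
  have up: "up_right_path p" if p: "p \<in># P" for p
  proof -
    have "length p \<noteq> 1"
    proof
      assume "length p = 1"
      then have "hd p = last p" by (cases p) auto
      with hd [OF p] last [OF p] show False by auto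
    qed
    with P(1) p show ?thesis by (cases p) (auto simp: up_right_path_def Suc_le_eq)
  qed
  have pe: "region K M e" if "p \<in># P" "e \<in> set (path_edges p)" for p e
    using that reg P(4) by (auto simp: in_edge_mset_iff)
  \<comment> \<open>\<open>\<phi>\<close> and \<open>\<psi>\<close> recover the forced first and
    last edge from the first and last vertex.\<close>
  define \<phi> where "\<phi> = (\<lambda>x::vertex. (x, if fst x = -1 then (0, snd x) else (0, 1)) :: edge)"
  define \<psi> where "\<psi> = (\<lambda>x::vertex. ((fst x, snd x - 1), x) :: edge)"
  have f: "first_edge p = \<phi> (hd p)" if p: "p \<in># P" for p
  proof -
    note fl = first_last_edge [OF up [OF p]]
    show ?thesis using pe [OF p fl(1)] hd [OF p] fl(3)
      by (cases "first_edge p") (auto simp: \<phi>_def)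
  qed
  have l: "last_edge p = \<psi> (last p)" if p: "p \<in># P" for p
  proof -
    note fl = first_last_edge [OF up [OF p]]
    show ?thesis using pe [OF p fl(2)] last [OF p] fl(4)
      by (cases "last_edge p") (auto simp: \<psi>_def)
  qed
  have "image_mset first_edge P = image_mset \<phi> (image_mset hd P)"
    unfolding image_mset.compositionality comp_def by (rule image_mset_cong) (rule f)
  also have "\<dots> = image_mset id (start_edges b n M)"
    unfolding P(2) image_mset.compositionality comp_def
    by (rule image_mset_cong) (auto simp: \<phi>_def dest!: start_edges_row)
  finally have 1: "image_mset first_edge P = start_edges b n M" by simp
  have "image_mset last_edge P = image_mset \<psi> (image_mset last P)"
    unfolding image_mset.compositionality comp_def by (rule image_mset_cong) (rule l)
  also have "\<dots> = vert (int M) \<mu>"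
    unfolding P(3) by (simp add: image_mset.compositionality comp_def \<psi>_def vert_def)
  finally have "P \<in> collections b n M \<mu>"
    using up 1 by (simp add: path_collections_def)
  with P(4) show ?thesis by blast
qed

text \<open>For \<open>M > 0\<close> every edge of \<open>region\<close> has an endpoint in the
  rectangle, where its multiplicity is one of the local numbers. For \<open>M = 0\<close> there are
  no vertices to read from, but there is at most one flow.\<close>

lemma inj_flow_config:
  assumes \<mu>: "set_mset \<mu> \<subseteq> {0..int K}"
  shows "inj_on (flow_config K M) (flows K b n M \<mu>)"
proof (rule inj_onI)
  fix E E' assume E: "E \<in> flows K b n M \<mu>" and E': "E' \<in> flows K b n M \<mu>"
    and eq: "flow_config K M E = flow_config K M E'"
  have num: "local_numbers E x = local_numbers E' x" if "x \<in> {0..int K} \<times> {1..int M}" for x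
    using that fun_cong [OF eq, of x] by (auto simp: flow_config_def split: if_splits)
  show "E = E'"
  proof (cases "M = 0")
    case True
    with E E' show ?thesis by (auto split: if_splits)
  next
    case False
    show ?thesis
    proof (rule multiset_eqI)
      fix e :: edge
      obtain a b c d where e: "e = ((a, b), (c, d))" by (metis surj_pair)
      show "count E e = count E' e"
      proof (cases "region K M e")
        case True
        then consider "c = a" "d = b + 1" "b \<ge> 1" "(a, b) \<in> {0..int K} \<times> {1..int M}"
          | "c = a" "d = b + 1" "b = 0" "0 \<le> a" "a \<le> int K"
          | "d = b" "c = a + 1" "(c, d) \<in> {0..int K} \<times> {1..int M}"
          unfolding e by force
        then show ?thesis
        proof cases
          case 1
          with num [of "(a, b)"] e show ?thesis by simp
        next
          case 2
          with num [of "(a, 1)"] e False show ?thesis by simp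
        next
          case 3
          with num [of "(c, d)"] e show ?thesis by simp
        qed
      next
        case False
        then have "e \<notin># E" "e \<notin># E'"
          using flowsD(1) [OF E \<mu>] flowsD(1) [OF E' \<mu>] by auto
        then show ?thesis by (metis count_eq_zero_iff)
      qed
    qed
  qed
qed

text \<open>An empty vertex has weight (1 - su)/(1 - su) = 1, so the product over the occupied
  vertices extends to the full rectangle.\<close>

lemma flow_config_weight:
  assumes us: "\<forall>u\<in>set us. 1 - s * u \<noteq> 0"
  shows "configuration_weight q s us (flow_config K (length us) E) = flow_weight q s K us E"
proof -
  let ?w = "\<lambda>x. case local_numbers E x of (i1, j1, i2, j2) \<Rightarrow>
        vertex_weight q s (us ! nat (snd x - 1)) i1 j1 i2 j2"
  let ?B = "{0..int K} \<times> {1..int (length us)}"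
  have "configuration_weight q s us (flow_config K (length us) E) =
      (\<Prod>x\<in>dom (flow_config K (length us) E). ?w x)"
    unfolding configuration_weight_def
    by (rule prod.cong)
      (auto simp: flow_config_def simp del: local_numbers.simps split: if_splits)
  also have "\<dots> = (\<Prod>x\<in>?B. ?w x)"
  proof (rule prod.mono_neutral_left)
    show "\<forall>x\<in>?B - dom (flow_config K (length us) E). ?w x = 1"
    proof
      fix x assume x: "x \<in> ?B - dom (flow_config K (length us) E)"
      then have "local_numbers E x = (0, 0, 0, 0)"
        by (auto simp: flow_config_def simp del: local_numbers.simps split: if_splits)
      moreover have "nat (snd x - 1) < length us" using x by auto
      then have "1 - s * us ! nat (snd x - 1) \<noteq> 0" using us nth_mem by blast
      ultimately show "?w x = 1" by (simp add: vertex_weight_def)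
    qed
  qed (auto simp: flow_config_def split: if_splits)
  also have "\<dots> = (\<Prod>(i, j)\<in>{..K} \<times> {..<length us}. ?w (int i, int j + 1))"
    by (rule prod.reindex_bij_witness [of _ "\<lambda>(i, j). (int i, int j + 1)" "\<lambda>(i, j). (nat i, nat (j - 1))"])
      (auto simp: add.commute [of 1])
  also have "\<dots> = (\<Prod>i\<le>K. \<Prod>j<length us. ?w (int i, int j + 1))"
    by (rule prod.cartesian_product [symmetric])
  also have "\<dots> = (\<Prod>j<length us. \<Prod>i\<le>K. ?w (int i, int j + 1))"
    by (rule prod.swap)
  finally show ?thesis by (simp add: flow_weight_def)
qed

lemma path_sum_flows:
  assumes us: "\<forall>u\<in>set us. 1 - s * u \<noteq> 0" and \<mu>: "set_mset \<mu> \<subseteq> {0..int K}"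
  shows "path_sum q s us (start_edges b n (length us)) (vert (int (length us)) \<mu>) =
    (\<Sum>E\<in>flows K b n (length us) \<mu>. flow_weight q s K us E)"
proof -
  have "configuration ` collections b n (length us) \<mu> =
      flow_config K (length us) ` flows K b n (length us) \<mu>"
    using collections_flow [OF _ \<mu>] flow_collection [OF _ \<mu>] by (fastforce simp: image_iff)
  then show ?thesis
    by (simp add: path_sum_def sum.reindex [OF inj_flow_config [OF \<mu>]] flow_config_weight [OF us])
qed

subsection \<open>The row recursion\<close>

text \<open>For \<open>x \<ge> 1\<close> these are the parts of the conjugate partition of
  \<open>\<mu>\<close>.\<close>

definition tail_size :: "int multiset \<Rightarrow> int \<Rightarrow> nat" where
  "tail_size \<mu> x = size {#i \<in># \<mu>. x \<le> i#}"

definition partition_sum ::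
  "complex \<Rightarrow> complex \<Rightarrow> nat \<Rightarrow> nat \<Rightarrow> nat \<Rightarrow> complex list \<Rightarrow> int multiset \<Rightarrow> complex" where
  "partition_sum q s K b n us \<mu> = (\<Sum>E\<in>flows K b n (length us) \<mu>. flow_weight q s K us E)"

definition row_weight ::
  "complex \<Rightarrow> complex \<Rightarrow> nat \<Rightarrow> complex \<Rightarrow> int multiset \<Rightarrow> int multiset \<Rightarrow> int multiset \<Rightarrow> complex" where
  "row_weight q s K u \<mu> X L = (\<Prod>i\<le>K. vertex_weight q s u
     (count L (int i)) (count X (int i)) (count \<mu> (int i)) (count X (int i + 1)))"

lemma tail_size_union [simp]: "tail_size (A + B) x = tail_size A x + tail_size B x"
  by (simp add: tail_size_def)

lemma tail_size_pred: "tail_size (image_mset (\<lambda>i. i - 1) A) x = tail_size A (x + 1)"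
  by (induction A) (auto simp: tail_size_def)

lemma tail_size_count: "tail_size A x = count A x + tail_size A (x + 1)"
  by (induction A) (auto simp: tail_size_def)

lemma row_step_count:
  assumes "row_step K b \<mu> X L"
  shows "count X i + count L i + (if i = -1 then b else 0) = count X (i + 1) + count \<mu> i"
  using assms arg_cong [of _ _ "\<lambda>S. count S i"]
  by (auto simp: row_step_def count_image_pred dest: arg_cong [of _ _ "\<lambda>S. count S i"])

text \<open>Cut the row just left of column \<open>i\<close>. No path leaves the row on the right,
  so whatever goes up beyond the cut came either through it or from below.\<close>

lemma row_step_tail:
  assumes "row_step K b \<mu> X L" "0 \<le> i"
  shows "count X i + tail_size L i = tail_size \<mu> i"
proof -
  have "tail_size (X + L + replicate_mset b (-1)) i = tail_size (image_mset (\<lambda>i. i - 1) X + \<mu>) i"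
    using assms(1) by (simp add: row_step_def)
  moreover have "tail_size (replicate_mset b (-1)) i = 0"
    using assms(2) by (simp add: tail_size_def)
  ultimately show ?thesis
    using tail_size_count [of X i] by (simp add: tail_size_pred)
qed

lemma row_step_size:
  assumes "row_step K b \<mu> X L"
  shows "size L + b = size \<mu>"
proof -
  have "size (X + L + replicate_mset b (-1)) = size (image_mset (\<lambda>i. i - 1) X + \<mu>)"
    using assms by (simp add: row_step_def)
  then show ?thesis by simp
qed

text \<open>By \<open>row_step_tail\<close> the lower boundary \<open>L\<close> determines
  \<open>X\<close>, and \<open>L\<close> has fixed size and finitely many possible columns.\<close>

lemma finite_row_steps: "finite {(X, L). row_step K b \<mu> X L}"
proof (rule inj_on_finite)
  show "inj_on snd {(X, L). row_step K b \<mu> X L}"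
  proof (rule inj_onI, clarsimp)
    fix X Y L assume st: "row_step K b \<mu> X L" "row_step K b \<mu> Y L"
    show "X = Y"
    proof (rule multiset_eqI)
      fix i show "count X i = count Y i"
      proof (cases "0 \<le> i")
        case True
        with st [THEN row_step_tail] show ?thesis by (metis add_right_cancel)
      next
        case False
        with st have "i \<notin># X" "i \<notin># Y" by (auto simp: row_step_def)
        then show ?thesis by (simp add: not_in_iff)
      qed
    qed
  qed
  show "snd ` {(X, L). row_step K b \<mu> X L} \<subseteq> multisets_of_size {0..int K} (size \<mu> - b)"
  proof clarify
    fix X L assume st: "row_step K b \<mu> X L"
    from row_step_size [OF st] st show "snd (X, L) \<in> multisets_of_size {0..int K} (size \<mu> - b)"
      by (simp add: multisets_of_size_def row_step_def)
  qed
qed auto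

lemma finite_flows: "finite (flows K b n M \<mu>)"
proof (induction M arbitrary: \<mu>)
  case (Suc M)
  then show ?case by (auto intro!: finite_SigmaI finite_row_steps)
qed auto

lemma count_vert:
  "count (vert j L) ((a, b), (c, d)) = (if b = j \<and> d = j + 1 \<and> c = a then count L a else 0)"
  by (induction L) (auto simp: vert_def)

lemma count_hor:
  "count (hor j X) ((a, b), (c, d)) = (if b = j \<and> d = j \<and> a = c - 1 then count X c else 0)"
  by (induction X) (auto simp: hor_def)

lemma flows_above:
  assumes "E \<in> flows K b n M \<mu>" "set_mset \<mu> \<subseteq> {0..int K}" "int M < y"
  shows "count E ((x, y), e) = 0"
  using flowsD(1) [OF assms(1,2)] assms(3) by (cases e) (force simp: count_eq_zero_iff)

lemma flows_top:
  assumes "E \<in> flows K b n M \<mu>" "set_mset \<mu> \<subseteq> {0..int K}"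
  shows "count E ((i, int M), (i, int M + 1)) = count \<mu> i"
proof (cases M)
  case 0
  with assms show ?thesis by (auto simp: count_vert split: if_splits)
next
  case (Suc M')
  with assms(1) obtain X L E' where E: "E = E' + hor (int M' + 1) X + vert (int M' + 1) \<mu>"
    and st: "row_step K b \<mu> X L" and E': "E' \<in> flows K b n M' L" by auto
  have "set_mset L \<subseteq> {0..int K}" using st by (simp add: row_step_def)
  from flows_above [OF E' this] show ?thesis
    by (simp add: E count_vert count_hor Suc)
qed

lemma flow_weight_snoc:
  assumes E: "E \<in> flows K b n (length us) L" and L: "set_mset L \<subseteq> {0..int K}"
  defines "r \<equiv> int (length us) + 1"
  shows "flow_weight q s K (us @ [u]) (E + hor r X + vert r \<mu>) =
    row_weight q s K u \<mu> X L * flow_weight q s K us E"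
proof -
  have "local_numbers (E + hor r X + vert r \<mu>) (i, int j + 1) = local_numbers E (i, int j + 1)"
    if "j < length us" for i j
    using that by (simp add: count_vert count_hor r_def)
  moreover have "local_numbers (E + hor r X + vert r \<mu>) (i, int (length us) + 1) =
      (count L i, count X i, count \<mu> i, count X (i + 1))" for i
    using flows_top [OF E L, of i] flows_above [OF E L] by (simp add: count_vert count_hor r_def)
  ultimately show ?thesis
    by (simp add: flow_weight_def row_weight_def nth_append del: local_numbers.simps)
qed

text \<open>\<open>E\<close> has no edge starting in row \<open>M + 1\<close>, so \<open>X\<close>
  can be read off the sum; cancellation in the conservation law then gives \<open>L\<close>.\<close>

lemma flows_Suc_inj:
  "inj_on (\<lambda>((X, L), E). E + hor (int M + 1) X + vert (int M + 1) \<mu>)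
     (SIGMA y:{(X, L). row_step K b \<mu> X L}. flows K b n M (snd y))"
proof (rule inj_onI, clarsimp)
  fix X L E Y L' E'
  let ?r = "int M + 1"
  assume st: "row_step K b \<mu> X L" "row_step K b \<mu> Y L'"
    and E: "E \<in> flows K b n M L" and E': "E' \<in> flows K b n M L'"
    and eq: "E + hor ?r X = E' + hor ?r Y"
  have L: "set_mset L \<subseteq> {0..int K}" "set_mset L' \<subseteq> {0..int K}"
    using st by (auto simp: row_step_def)
  have XY: "X = Y"
  proof (rule multiset_eqI)
    fix i
    show "count X i = count Y i"
      using arg_cong [OF eq, of "\<lambda>S. count S ((i - 1, ?r), (i, ?r))"]
        flows_above [OF E L(1)] flows_above [OF E' L(2)] by (simp add: count_hor)
  qed
  with eq have "E = E'" by simp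
  moreover have "L = L'"
    using st unfolding row_step_def XY by (metis add_left_cancel add_right_cancel)
  ultimately show "X = Y \<and> L = L' \<and> E = E'" using XY by simp
qed

lemma partition_sum_Nil:
  "partition_sum q s K b n [] \<mu> = (if \<mu> = replicate_mset n 0 then 1 else 0)"
  by (simp add: partition_sum_def flow_weight_def)

lemma partition_sum_snoc:
  "partition_sum q s K b n (us @ [u]) \<mu> =
    (\<Sum>(X, L)\<in>{(X, L). row_step K b \<mu> X L}.
      row_weight q s K u \<mu> X L * partition_sum q s K b n us L)"
proof -
  let ?S = "{(X, L). row_step K b \<mu> X L}" and ?r = "int (length us) + 1"
  have "partition_sum q s K b n (us @ [u]) \<mu> =
    (\<Sum>((X, L), E)\<in>(SIGMA y:?S. flows K b n (length us) (snd y)).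
      flow_weight q s K (us @ [u]) (E + hor ?r X + vert ?r \<mu>))"
    unfolding partition_sum_def length_append_singleton flows.simps
    by (subst sum.reindex [OF flows_Suc_inj]) (simp add: case_prod_unfold comp_def)
  also have "\<dots> = (\<Sum>y\<in>?S. \<Sum>E\<in>flows K b n (length us) (snd y).
      flow_weight q s K (us @ [u]) (E + hor ?r (fst y) + vert ?r \<mu>))"
    using finite_row_steps [of K b \<mu>]
    by (subst sum.Sigma) (auto simp: finite_flows case_prod_unfold)
  also have "\<dots> = (\<Sum>y\<in>?S. row_weight q s K u \<mu> (fst y) (snd y) * partition_sum q s K b n us (snd y))"
    unfolding partition_sum_def sum_distrib_left
    by (intro sum.cong refl flow_weight_snoc) (auto simp: row_step_def)
  finally show ?thesis by (simp add: case_prod_unfold)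
qed

text \<open>The number of paths entering column \<open>x\<close> horizontally, when \<open>J\<close> is the set of columns
  \<open>x \<ge> 1\<close> with an occupied West edge.\<close>

definition occ :: "nat \<Rightarrow> nat set \<Rightarrow> nat \<Rightarrow> nat" where
  "occ b J x = (if x = 0 then b else if x \<in> J then 1 else 0)"

lemma vertex_weight_0: "2 \<le> j1 \<Longrightarrow> vertex_weight q s u i1 j1 i2 j2 = 0"
  by (simp add: vertex_weight_def)

text \<open>A horizontal edge used twice kills the row weight, so \<open>X\<close> is the indicator
  of a set \<open>J\<close> of columns together with \<open>b\<close> copies of column 0, and
  conservation determines \<open>L\<close> from \<open>J\<close>. The function \<open>g\<close>
  stands for the values of the lower rows, which in the applications depend on \<open>J\<close>
  alone.\<close>

lemma partition_sum_bits:
  assumes b: "b \<le> 1" and \<mu>: "set_mset \<mu> \<subseteq> {0..int K}"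
    and g: "\<And>J L. J \<subseteq> {1..K} \<Longrightarrow> set_mset L \<subseteq> {0..int K} \<Longrightarrow> size L + b = size \<mu> \<Longrightarrow>
      (\<And>x. x \<in> {1..K} \<Longrightarrow> occ b J x + tail_size L (int x) = tail_size \<mu> (int x)) \<Longrightarrow>
      partition_sum q s K b n us L = g J"
  shows "partition_sum q s K b n (us @ [u]) \<mu> =
    (\<Sum>J\<in>Pow {1..K}. (\<Prod>i\<le>K. vertex_weight q s u
       (count \<mu> (int i) + occ b J (Suc i) - occ b J i) (occ b J i)
       (count \<mu> (int i)) (occ b J (Suc i))) * g J)"
proof -
  let ?S = "{(X, L). row_step K b \<mu> X L}"
  define S' where "S' = {(X, L). row_step K b \<mu> X L \<and> (\<exists>i. 2 \<le> count X i)}"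
  \<comment> \<open>The sets \<open>J\<close> that come from no row: a path enters column
    \<open>i\<close> and leaves it neither upwards nor to the right, so \<open>L\<close> would need
    a negative count. Truncated subtraction turns this count into 0, and the vertex weight of (0, 1,
    0, 0) is 0, so these sets may be included in the sum.\<close>
  define T' where "T' = {J \<in> Pow {1..K}. \<exists>i\<le>K. count \<mu> (int i) = 0 \<and> occ b J i = 1 \<and> occ b J (Suc i) = 0}"
  define X where "X J = mset_set (int ` J) + replicate_mset b 0" for J
  define L where "L J = image_mset (\<lambda>i. i - 1) (X J) + \<mu> - (X J + replicate_mset b (-1))" for J
  define jset where "jset Z = {x \<in> {1..K}. int x \<in># Z}" for Z :: "int multiset"
  have cX: "count (X J) i = (if 0 \<le> i then occ b J (nat i) else 0)" if "J \<subseteq> {1..K}" for J i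
  proof -
    have fin: "finite J" using that finite_subset by blast
    have "0 \<notin> J" using that by auto
    have "i \<in> int ` J \<longleftrightarrow> 0 \<le> i \<and> nat i \<in> J" by (metis image_iff int_nat_eq nat_int of_nat_0_le_iff)
    then show ?thesis using fin \<open>0 \<notin> J\<close> by (auto simp: X_def count_mset_set' occ_def)
  qed
  have cL: "count (L J) i =
      (if i = -1 then occ b J 0 else if 0 \<le> i then occ b J (nat i + 1) else 0) + count \<mu> i -
      ((if 0 \<le> i then occ b J (nat i) else 0) + (if i = -1 then b else 0))"
    if "J \<subseteq> {1..K}" for J i
    by (auto simp: L_def count_image_pred cX [OF that] nat_add_distrib)
  have b01: "occ b J i \<in> {0, 1}" for J i using b by (auto simp: occ_def)
  have bK: "occ b J i = 0" if "J \<subseteq> {1..K}" "i > K" for J i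
    using that by (auto simp: occ_def)
  have \<mu>0: "count \<mu> i = 0" if "i < 0 \<or> i > int K" for i
    using that \<mu> by (force simp: count_eq_zero_iff)
  have step: "row_step K b \<mu> (X J) (L J)" if J: "J \<in> Pow {1..K} - T'" for J
  proof -
    have J': "J \<subseteq> {1..K}" using J by auto
    have nT: "\<not> (count \<mu> (int i) = 0 \<and> occ b J i = 1 \<and> occ b J (Suc i) = 0)" if "i \<le> K" for i
      using J that by (auto simp: T'_def)
    have "x \<le> y + c" if "\<not> (c = 0 \<and> x = 1 \<and> y = 0)" "x \<in> {0, 1}" for x y c :: nat
      using that by auto
    from this [OF nT b01] have le: "occ b J i \<le> occ b J (Suc i) + count \<mu> (int i)" if "i \<le> K" for i
      using that .
    have "X J + replicate_mset b (-1) \<subseteq># image_mset (\<lambda>i. i - 1) (X J) + \<mu>"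
    proof (rule mset_subset_eqI)
      fix i
      show "count (X J + replicate_mset b (-1)) i \<le> count (image_mset (\<lambda>i. i - 1) (X J) + \<mu>) i"
      proof (cases "0 \<le> i \<and> i \<le> int K")
        case True
        then show ?thesis
          using le [of "nat i"]
          by (auto simp: count_image_pred cX [OF J'] nat_add_distrib)
      next
        case False
        moreover have "occ b J (nat i) = 0" if "i > int K" using that bK [OF J', of "nat i"] by simp
        moreover have "occ b J 0 = b" by (simp add: occ_def)
        ultimately show ?thesis
          by (auto simp: count_image_pred cX [OF J'])
      qed
    qed
    then have "X J + L J + replicate_mset b (-1) = image_mset (\<lambda>i. i - 1) (X J) + \<mu>"
      unfolding L_def by (metis subset_mset.diff_add union_assoc union_commute)
    moreover have "set_mset (X J) \<subseteq> {0..int K}"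
    proof -
      have "finite J" using J' finite_subset by blast
      then have "set_mset (X J) \<subseteq> int ` J \<union> {0}" by (auto simp: X_def)
      moreover have "int ` J \<union> {0} \<subseteq> {0..int K}" using J' by auto
      ultimately show ?thesis by (rule subset_trans)
    qed
    moreover have "set_mset (L J) \<subseteq> {0..int K}"
    proof
      fix i assume i: "i \<in># L J"
      have occ0: "occ b J 0 = b" by (simp add: occ_def)
      have "count (L J) i = 0" if "i < 0 \<or> i > int K"
      proof (cases "i < 0")
        case True
        then show ?thesis using \<mu>0 [OF that] by (simp add: cL [OF J'] occ0)
      next
        case False
        then have "K < nat i" using that by linarith
        then have "occ b J (nat i + 1) = 0" by (intro bK [OF J']) simp
        with False show ?thesis using \<mu>0 [OF that] by (simp add: cL [OF J'])
      qed
      moreover have "count (L J) i \<noteq> 0" using i by simp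
      ultimately show "i \<in> {0..int K}" by fastforce
    qed
    ultimately show ?thesis by (simp add: row_step_def)
  qed
  have inv: "X (jset Y) = Y \<and> L (jset Y) = M \<and> jset Y \<in> Pow {1..K} - T' \<and>
      (\<forall>i. occ b (jset Y) i = count Y (int i))"
    if Y: "row_step K b \<mu> Y M" "\<forall>i. count Y i < 2" for Y M
  proof -
    have sub: "jset Y \<subseteq> {1..K}" by (auto simp: jset_def)
    have Y0: "count Y i = 0" if "i < 0 \<or> i > int K" for i
      using that Y(1) by (force simp: count_eq_zero_iff row_step_def)
    have M0: "count M (-1) = 0"
      using Y(1) by (force simp: count_eq_zero_iff row_step_def)
    \<comment> \<open>For \<open>i = 0\<close> the count is forced to be \<open>b\<close> by
      conservation at column -1.\<close>
    have bit: "occ b (jset Y) i = count Y (int i)" for i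
    proof (cases "i = 0")
      case True
      with row_step_count [OF Y(1), of "-1"] Y0 [of "-1"] \<mu>0 [of "-1"] M0 show ?thesis
        by (simp add: occ_def)
    next
      case False
      have "count Y (int i) \<le> 1" using Y(2) [rule_format, of "int i"] by simp
      then have "count Y (int i) = (if int i \<in># Y then 1 else 0)"
        by (auto simp: not_in_iff intro: le_antisym)
      moreover have "i \<notin> {1..K} \<Longrightarrow> count Y (int i) = 0" using False Y0 [of "int i"] by auto
      ultimately show ?thesis using False
        by (cases "i \<in> {1..K}") (simp_all add: occ_def jset_def)
    qed
    have XY: "X (jset Y) = Y"
      by (rule multiset_eqI) (use Y0 in \<open>auto simp: cX [OF sub] bit\<close>)
    have "Y + M + replicate_mset b (-1) = image_mset (\<lambda>i. i - 1) Y + \<mu>"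
      using Y(1) by (simp add: row_step_def)
    then have "L (jset Y) = Y + M + replicate_mset b (-1) - (Y + replicate_mset b (-1))"
      by (simp only: L_def XY)
    then have "L (jset Y) = M" by (simp add: multiset_eq_iff)
    moreover have "jset Y \<notin> T'"
    proof
      assume "jset Y \<in> T'"
      then obtain i where "count \<mu> (int i) = 0" "count Y (int i) = 1" "count Y (int (Suc i)) = 0"
        by (auto simp: T'_def bit)
      with row_step_count [OF Y(1), of "int i"] show False by (simp add: add.commute)
    qed
    ultimately show ?thesis using sub XY bit by auto
  qed
  have jX: "jset (X J) = J" if J: "J \<in> Pow {1..K}" for J
  proof -
    have "J \<subseteq> {1..K}" using J by simp
    then have "int x \<in># X J \<longleftrightarrow> x \<in> J" if "x \<in> {1..K}" for x
      using that cX [of J "int x"] by (auto simp: occ_def simp flip: count_greater_zero_iff)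
    then show ?thesis using J by (auto simp: jset_def)
  qed
  define G where "G = (\<lambda>(X, L). row_weight q s K u \<mu> X L * partition_sum q s K b n us L)"
  define H where "H J = (\<Prod>i\<le>K. vertex_weight q s u
       (count \<mu> (int i) + occ b J (Suc i) - occ b J i) (occ b J i)
       (count \<mu> (int i)) (occ b J (Suc i))) * g J" for J
  have "sum G ?S = sum G (?S - S')"
  proof (rule sum.mono_neutral_right)
    show "\<forall>a\<in>?S - (?S - S'). G a = 0"
    proof
      fix a assume "a \<in> ?S - (?S - S')"
      then obtain Y M i where a: "a = (Y, M)" "row_step K b \<mu> Y M" "2 \<le> count Y i"
        by (auto simp: S'_def)
      then have "i \<in># Y" by (metis count_eq_zero_iff not_numeral_le_zero)
      then have "i \<in> {0..int K}" using a(2) by (auto simp: row_step_def simp del: atLeastAtMost_iff)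
      then have "0 \<le> i" "nat i \<le> K" by auto
      then have "row_weight q s K u \<mu> Y M = 0"
        using a(3) unfolding row_weight_def
        by (intro prod_zero) (auto intro!: bexI [of _ "nat i"] vertex_weight_0)
      then show "G a = 0" by (simp add: a G_def)
    qed
  qed (use finite_row_steps in auto)
  also have "\<dots> = sum H (Pow {1..K} - T')"
  proof (rule sum.reindex_bij_witness [where i = "\<lambda>J. (X J, L J)" and j = "\<lambda>(Y, M). jset Y"])
    fix a assume a: "a \<in> ?S - S'"
    obtain Y M where aYM: "a = (Y, M)" by (cases a)
    with a have YM: "row_step K b \<mu> Y M" "\<forall>i. count Y i < 2"
      by (auto simp: S'_def not_le)
    note i = inv [OF YM]
    show "(X (case a of (Y, M) \<Rightarrow> jset Y), L (case a of (Y, M) \<Rightarrow> jset Y)) = a"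
      using i by (simp add: aYM)
    show "(case a of (Y, M) \<Rightarrow> jset Y) \<in> Pow {1..K} - T'"
      using i by (simp add: aYM)
    let ?J = "jset Y"
    have bit: "occ b ?J i = count Y (int i)" for i using i by blast
    have g': "partition_sum q s K b n us M = g ?J"
    proof (rule g)
      show "?J \<subseteq> {1..K}" using i by blast
      show "set_mset M \<subseteq> {0..int K}" using YM(1) by (simp add: row_step_def)
      show "size M + b = size \<mu>" by (rule row_step_size [OF YM(1)])
      fix x assume "x \<in> {1..K}"
      show "occ b ?J x + tail_size M (int x) = tail_size \<mu> (int x)"
        using row_step_tail [OF YM(1), of "int x"] by (simp add: bit)
    qed
    have "count M (int i) = count \<mu> (int i) + occ b ?J (Suc i) - occ b ?J i" for i
      using row_step_count [OF YM(1), of "int i"] by (simp add: bit add.commute)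
    then show "H (case a of (Y, M) \<Rightarrow> jset Y) = G a"
      by (simp add: aYM g' G_def H_def row_weight_def bit add.commute)
  next
    fix J assume J: "J \<in> Pow {1..K} - T'"
    show "(case (X J, L J) of (Y, M) \<Rightarrow> jset Y) = J" using jX J by simp
    have "count (X J) i < 2" for i
      using b01 [of J "nat i"] J by (auto simp: cX)
    then show "(X J, L J) \<in> ?S - S'"
      using step [OF J] by (auto simp: S'_def not_le)
  qed
  also have "\<dots> = sum H (Pow {1..K})"
  proof (rule sum.mono_neutral_left)
    show "\<forall>J\<in>Pow {1..K} - (Pow {1..K} - T'). H J = 0"
    proof
      fix J assume "J \<in> Pow {1..K} - (Pow {1..K} - T')"
      then obtain i where "i \<le> K" "count \<mu> (int i) = 0" "occ b J i = 1" "occ b J (Suc i) = 0"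
        unfolding T'_def by blast
      then have "(\<Prod>i\<le>K. vertex_weight q s u
           (count \<mu> (int i) + occ b J (Suc i) - occ b J i) (occ b J i)
           (count \<mu> (int i)) (occ b J (Suc i))) = 0"
        by (intro prod_zero) (auto intro!: bexI [of _ i] simp: vertex_weight_def)
      then show "H J = 0" by (simp add: H_def)
    qed
  qed auto
  finally show ?thesis
    unfolding partition_sum_snoc G_def H_def .
qed

section \<open>Transfer matrices along a row\<close>

fun transfer :: "nat \<Rightarrow> (nat \<Rightarrow> nat \<Rightarrow> nat \<Rightarrow> complex) \<Rightarrow> nat \<Rightarrow> nat \<Rightarrow> complex" where
  "transfer b f 0 j = (if j = b then 1 else 0)"
| "transfer b f (Suc x) j = transfer b f x 0 * f x 0 j + transfer b f x 1 * f x 1 j"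

text \<open>Splitting by whether \<open>Suc x\<close> belongs to \<open>J\<close> sums out the last
  bit. The test function \<open>\<phi>\<close> is arbitrary so that the last matrix can be absorbed
  into it.\<close>

lemma sum_bits_transfer:
  assumes "b \<le> 1"
  shows "(\<Sum>J\<in>Pow {1..x}. (\<Prod>i<x. f i (occ b J i) (occ b J (Suc i))) * \<phi> (occ b J x)) =
    transfer b f x 0 * \<phi> 0 + transfer b f x 1 * \<phi> 1"
proof (induction x arbitrary: \<phi>)
  case 0
  have "b = 0 \<or> b = 1" using assms by auto
  then show ?case by (auto simp: occ_def)
next
  case (Suc x)
  let ?P = "\<lambda>x J. \<Prod>i<x. f i (occ b J i) (occ b J (Suc i))"
  have inj: "inj_on (insert (Suc x)) (Pow {1..x})"
  proof (rule inj_onI)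
    fix A B assume AB: "A \<in> Pow {1..x}" "B \<in> Pow {1..x}" "insert (Suc x) A = insert (Suc x) B"
    then have "Suc x \<notin> A" "Suc x \<notin> B" by auto
    with AB(3) show "A = B" by (metis insert_ident)
  qed
  have "{1..Suc x} = insert (Suc x) {1..x}" by auto
  then have "(\<Sum>J\<in>Pow {1..Suc x}. ?P (Suc x) J * \<phi> (occ b J (Suc x))) =
      (\<Sum>J\<in>Pow {1..x}. ?P (Suc x) J * \<phi> (occ b J (Suc x))) +
      (\<Sum>J\<in>insert (Suc x) ` Pow {1..x}. ?P (Suc x) J * \<phi> (occ b J (Suc x)))"
    by (simp only: Pow_insert) (subst sum.union_disjoint, auto)
  also have "(\<Sum>J\<in>insert (Suc x) ` Pow {1..x}. ?P (Suc x) J * \<phi> (occ b J (Suc x))) =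
      (\<Sum>J\<in>Pow {1..x}. ?P (Suc x) (insert (Suc x) J) * \<phi> (occ b (insert (Suc x) J) (Suc x)))"
    by (rule sum.reindex_cong [of "insert (Suc x)"]) (use inj in auto)
  also have "\<dots> = (\<Sum>J\<in>Pow {1..x}. ?P x J * (f x (occ b J x) 1 * \<phi> 1))"
  proof (rule sum.cong [OF refl])
    fix J assume "J \<in> Pow {1..x}"
    have eq: "occ b (insert (Suc x) J) i = occ b J i" if "i \<le> x" for i
      using that by (simp add: occ_def)
    have "?P x (insert (Suc x) J) = ?P x J"
      by (intro prod.cong refl) (simp add: eq)
    moreover have "occ b (insert (Suc x) J) (Suc x) = 1" by (simp add: occ_def)
    ultimately show "?P (Suc x) (insert (Suc x) J) * \<phi> (occ b (insert (Suc x) J) (Suc x)) =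
        ?P x J * (f x (occ b J x) 1 * \<phi> 1)" by (simp add: eq)
  qed
  also have "(\<Sum>J\<in>Pow {1..x}. ?P (Suc x) J * \<phi> (occ b J (Suc x))) =
      (\<Sum>J\<in>Pow {1..x}. ?P x J * (f x (occ b J x) 0 * \<phi> 0))"
    by (intro sum.cong refl) (auto simp: occ_def)
  finally show ?case
    using Suc.IH [of "\<lambda>j. f x j 0 * \<phi> 0 + f x j 1 * \<phi> 1"]
    by (simp add: sum.distrib [symmetric] algebra_simps)
qed

subsection \<open>Geometric progressions of variables\<close>

definition ratio_prod :: "complex \<Rightarrow> complex \<Rightarrow> complex \<Rightarrow> nat \<Rightarrow> complex" where
  "ratio_prod q s v h = (\<Prod>i<h. (q ^ i * v - s) / (1 - s * q ^ i * v))"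

lemma sum_bits_transfer_last:
  assumes "b \<le> 1"
  shows "(\<Sum>J\<in>Pow {1..K}. \<Prod>i\<le>K. f i (occ b J i) (occ b J (Suc i))) = transfer b f (Suc K) 0"
proof -
  have "(\<Sum>J\<in>Pow {1..K}. \<Prod>i\<le>K. f i (occ b J i) (occ b J (Suc i))) =
      (\<Sum>J\<in>Pow {1..K}. (\<Prod>i<K. f i (occ b J i) (occ b J (Suc i))) * f K (occ b J K) 0)"
  proof (rule sum.cong [OF refl])
    fix J assume "J \<in> Pow {1..K}"
    then have "occ b J (Suc K) = 0" by (auto simp: occ_def)
    then show "(\<Prod>i\<le>K. f i (occ b J i) (occ b J (Suc i))) =
        (\<Prod>i<K. f i (occ b J i) (occ b J (Suc i))) * f K (occ b J K) 0"
      by (simp add: lessThan_Suc_atMost [symmetric])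
  qed
  with sum_bits_transfer [OF assms, of f K "\<lambda>j. f K j 0"] show ?thesis by simp
qed

text \<open>One column step in reduced form: \<open>p\<close> is q^(N - h), \<open>Q\<close> is q^m
  for m paths going up in the column, and \<open>B\<close> is q^(h - 1) * v, so that
  \<open>p * B\<close> is the row variable. The factor \<open>1 - s * B\<close> replaces
  \<open>B - s\<close> after the ratio products are aligned, and \<open>1 - s * (p * B)\<close>
  cancels the denominator of the vertex weights.\<close>

lemma column_identities:
  fixes p Q B s :: complex
  shows "(1 - p) * (1 - s * Q * (p * B)) + p * (1 - s * B) * (1 - Q) = (1 - p * Q) * (1 - s * (p * B))"
    and "(1 - p) * ((1 - s\<^sup>2 * Q) * (p * B)) + p * (1 - s * B) * (p * B - s * Q) =
      p * (B - s * Q) * (1 - s * (p * B))"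
  by (simp_all add: algebra_simps power2_eq_square)

text \<open>The two components of the row transfer, for \<open>h x\<close> paths leaving the row upwards in
  the columns from \<open>x\<close> on, stay proportional to \<open>1 - q^(N - h)\<close> and \<open>q^(N - h) * (q^(h - 1) * v - s)\<close>. This
  shape is forced by the columns without outgoing vertical edge, and it is preserved only because
  the row variable continues the geometric progression.\<close>

lemma row_transfer:
  fixes q s v z :: complex and h :: "nat \<Rightarrow> nat"
  assumes N: "0 < N" and h1: "h 1 \<le> N" and anti: "\<And>x. 1 \<le> x \<Longrightarrow> h (Suc x) \<le> h x"
    and nz: "\<And>i. i < N \<Longrightarrow> 1 - s * q ^ i * v \<noteq> 0"
    and f: "\<And>x j j'. 1 \<le> x \<Longrightarrow> f x j j' = ratio_prod q s v (h x - j) *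
      vertex_weight q s (q ^ (N - 1) * v) (h x - h (Suc x) + j' - j) j (h x - h (Suc x)) j'"
    and t0: "transfer b f 1 0 = (1 - q ^ (N - h 1)) * z"
    and t1: "0 < h 1 \<Longrightarrow> transfer b f 1 1 = q ^ (N - h 1) * (q ^ (h 1 - 1) * v - s) * z"
    and x: "1 \<le> x"
  shows "transfer b f x 0 = (1 - q ^ (N - h x)) * z * (\<Prod>y=1..<x. ratio_prod q s v (h y)) \<and>
    (0 < h x \<longrightarrow> transfer b f x 1 =
      q ^ (N - h x) * (q ^ (h x - 1) * v - s) * z * (\<Prod>y=1..<x. ratio_prod q s v (h y)))"
  using x
proof (induction x rule: nat_induct_at_least)
  case base
  then show ?case using t0 t1 by simp
next
  case (Suc x)
  let ?A = "ratio_prod q s v" and ?P = "\<Prod>y=1..<x. ratio_prod q s v (h y)" and ?u = "q ^ (N - 1) * v"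
  have c: "1 - s * ?u \<noteq> 0" using nz [of "N - 1"] N by (simp add: mult.assoc)
  have hN: "h x \<le> N" using Suc.hyps
    by (induction x rule: nat_induct_at_least) (use h1 anti le_trans in blast)+
  have P: "(\<Prod>y=1..<Suc x. ?A (h y)) = ?P * ?A (h x)"
    using Suc.hyps by (simp add: prod.atLeastLessThan_Suc)
  show ?case
  proof (cases "h x = 0")
    \<comment> \<open>Nothing is known here about component 1 of the vector;
      \<open>f x 1 0 = 0\<close> removes it, since a path entering the column would have no way
      up.\<close>
    case True
    then have "h (Suc x) = 0" using anti [OF Suc.hyps] by simp
    moreover have "f x 0 0 = 1" using c by (simp add: f [OF Suc.hyps] True ratio_prod_def vertex_weight_def)
    moreover have "f x 1 0 = 0" using anti [OF Suc.hyps] by (simp add: f [OF Suc.hyps] True vertex_weight_def)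
    ultimately show ?thesis using Suc.IH True P by (simp add: ratio_prod_def)
  next
    case False
    define m where "m = h x - h (Suc x)"
    define p Q B where "p = q ^ (N - h x)" and "Q = q ^ m" and "B = q ^ (h x - 1) * v"
    have m: "h (Suc x) = h x - m" "m \<le> h x" using anti [OF Suc.hyps] by (auto simp: m_def)
    have u: "?u = p * B"
    proof -
      have "N - 1 = (N - h x) + (h x - 1)" using False hN by simp
      then show ?thesis by (simp add: p_def B_def power_add mult.assoc)
    qed
    have Bnz: "1 - s * B \<noteq> 0" using nz [of "h x - 1"] False hN by (simp add: B_def mult.assoc)
    obtain h' where h': "h x = Suc h'" using False by (cases "h x") auto
    \<comment> \<open>If a path enters the column from the left, the lower row has one path fewer to
      account for. The missing ratio is supplied by the factor \<open>B - s\<close> of component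
      1.\<close>
    have A: "?A (h x - 1) * (B - s) = ?A (h x) * (1 - s * B)"
      using Bnz by (simp add: ratio_prod_def h' B_def mult.assoc)
    have T0: "transfer b f x 0 = (1 - p) * z * ?P"
      and T1: "transfer b f x 1 = p * (B - s) * z * ?P"
      using Suc.IH False by (simp_all add: p_def B_def)
    define c where "c = 1 - s * (p * B)"
    have c: "c \<noteq> 0" using c u by (simp add: c_def)
    have f00: "f x 0 0 = ?A (h x) * ((1 - s * Q * (p * B)) / c)"
      and f01: "f x 0 1 = ?A (h x) * ((1 - s\<^sup>2 * Q) * (p * B) / c)"
      and f10: "f x 1 0 = ?A (h x - 1) * ((1 - Q) / c)"
      and f11: "f x 1 1 = ?A (h x - 1) * ((p * B - s * Q) / c)"
      unfolding f [OF Suc.hyps] u m_def [symmetric] Q_def c_def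
      by (cases m; simp add: vertex_weight_def)+
    have comb: "(1 - p) * z * P * (A * (n / c)) + p * (B - s) * z * P * (A' * (n' / c)) =
        ((1 - p) * A * n + p * (A' * (B - s)) * n') / c * z * P" for P A A' n n'
      using c by (simp add: field_simps)
    have comb': "((1 - p) * a * n + p * (a * (1 - s * B)) * n') / c * z * P =
        ((1 - p) * n + p * (1 - s * B) * n') / c * a * z * P" for P a n n'
      by (simp add: algebra_simps)
    have "transfer b f (Suc x) 0 = ((1 - p) * ?A (h x) * (1 - s * Q * (p * B)) +
        p * (?A (h x - 1) * (B - s)) * (1 - Q)) / c * z * ?P"
      unfolding transfer.simps T0 T1 f00 f10 by (rule comb)
    also have "\<dots> = ((1 - p) * (1 - s * Q * (p * B)) + p * (1 - s * B) * (1 - Q)) / c * ?A (h x) * z * ?P"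
      unfolding A by (rule comb')
    also have "\<dots> = (1 - p * Q) * z * (?P * ?A (h x))"
      using c unfolding column_identities c_def [symmetric] by simp
    also have "p * Q = q ^ (N - h (Suc x))"
      using hN m by (simp add: p_def Q_def power_add [symmetric])
    finally have 1: "transfer b f (Suc x) 0 = (1 - q ^ (N - h (Suc x))) * z * (?P * ?A (h x))" .
    have "transfer b f (Suc x) 1 = ((1 - p) * ?A (h x) * ((1 - s\<^sup>2 * Q) * (p * B)) +
        p * (?A (h x - 1) * (B - s)) * (p * B - s * Q)) / c * z * ?P"
      unfolding transfer.simps T0 T1 f01 f11 by (rule comb)
    also have "\<dots> = ((1 - p) * ((1 - s\<^sup>2 * Q) * (p * B)) + p * (1 - s * B) * (p * B - s * Q)) / c *
        ?A (h x) * z * ?P"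
      unfolding A by (rule comb')
    also have "\<dots> = p * (B - s * Q) * z * (?P * ?A (h x))"
      using c unfolding column_identities c_def [symmetric] by simp
    finally have 2: "transfer b f (Suc x) 1 = p * (B - s * Q) * z * (?P * ?A (h x))" .
    have 3: "p * (B - s * Q) = q ^ (N - h (Suc x)) * (q ^ (h (Suc x) - 1) * v - s)" if "0 < h (Suc x)"
    proof -
      have "h x - 1 = m + (h (Suc x) - 1)" "N - h (Suc x) = (N - h x) + m" using m that hN by auto
      then show ?thesis by (simp add: p_def Q_def B_def power_add algebra_simps)
    qed
    show ?thesis using 1 2 3 by (simp only: P) simp
  qed
qed

text \<open>By \<open>row_step_tail\<close>, the closed form of the lower rows splits over the
  columns x \<ge> 1 up to the coefficient \<open>D\<close>, whose argument depends only on the bit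
  entering column 1. Hence \<open>t0\<close> and \<open>t1\<close> are the entries of the vector at
  column 1, and \<open>row_transfer\<close> carries them to the right end. The case without nonzero
  parts is stated separately: if \<open>q ^ N = 1\<close>, a nonzero \<open>t0\<close> is not of the
  form \<open>(1 - q ^ N) * z\<close>.\<close>

lemma partition_sum_closed_snoc:
  fixes q s v z :: complex and D :: "nat \<Rightarrow> complex"
  assumes b: "b \<le> 1" and \<mu>: "set_mset \<mu> \<subseteq> {0..int K}" and K: "1 \<le> K"
    and N: "0 < N" and hN: "tail_size \<mu> 1 \<le> N"
    and nz: "\<And>i. i < N \<Longrightarrow> 1 - s * q ^ i * v \<noteq> 0"
    and IH: "\<And>L. set_mset L \<subseteq> {0..int K} \<Longrightarrow> size L + b = size \<mu> \<Longrightarrow> tail_size L 1 \<le> tail_size \<mu> 1 \<Longrightarrow>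
      partition_sum q s K b n us L =
      D (tail_size L 1) * (\<Prod>x=1..K. ratio_prod q s v (tail_size L (int x)))"
  defines "u \<equiv> q ^ (N - 1) * v"
  defines "t0 \<equiv> vertex_weight q s u (count \<mu> 0 - b) b (count \<mu> 0) 0 * D (tail_size \<mu> 1)"
    and "t1 \<equiv> vertex_weight q s u (count \<mu> 0 + 1 - b) b (count \<mu> 0) 1 * D (tail_size \<mu> 1 - 1)"
  shows "tail_size \<mu> 1 = 0 \<Longrightarrow> partition_sum q s K b n (us @ [u]) \<mu> = t0"
    and "t0 = (1 - q ^ (N - tail_size \<mu> 1)) * z \<Longrightarrow>
      (0 < tail_size \<mu> 1 \<Longrightarrow>
        t1 = q ^ (N - tail_size \<mu> 1) * (q ^ (tail_size \<mu> 1 - 1) * v - s) * z) \<Longrightarrow>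
      partition_sum q s K b n (us @ [u]) \<mu> =
        (1 - q ^ N) * z * (\<Prod>x=1..K. ratio_prod q s v (tail_size \<mu> (int x)))"
proof -
  define h where "h x = tail_size \<mu> (int x)" for x :: nat
  let ?A = "ratio_prod q s v"
  define w where "w i j j' = vertex_weight q s u (count \<mu> (int i) + j' - j) j (count \<mu> (int i)) j'" for i j j'
  \<comment> \<open>Column 0 takes \<open>D\<close> through its outgoing bit; each later column
    takes its ratio product through its incoming bit.\<close>
  define f where "f i j j' = (if i = 0 then w i j j' * D (h 1 - j') else ?A (h i - j) * w i j j')"
    for i j j'
  have hS: "h x = count \<mu> (int x) + h (Suc x)" for x
    using tail_size_count [of \<mu> "int x"] by (simp add: h_def add.commute)
  have hK: "h (Suc K) = 0"
  proof -
    have "set_mset {#i \<in># \<mu>. int (Suc K) \<le> i#} = {}" using \<mu> by auto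
    then show ?thesis unfolding h_def tail_size_def by simp
  qed
  have "partition_sum q s K b n (us @ [u]) \<mu> =
    (\<Sum>J\<in>Pow {1..K}. (\<Prod>i\<le>K. w i (occ b J i) (occ b J (Suc i))) *
      (D (h 1 - occ b J 1) * (\<Prod>x=1..K. ?A (h x - occ b J x))))"
    unfolding w_def
  proof (rule partition_sum_bits [OF b \<mu>])
    fix J L assume L: "set_mset L \<subseteq> {0..int K}" "size L + b = size \<mu>"
      and t: "\<And>x. x \<in> {1..K} \<Longrightarrow> occ b J x + tail_size L (int x) = tail_size \<mu> (int x)"
    have tL: "tail_size L (int x) = h x - occ b J x" if "x \<in> {1..K}" for x
      using t [OF that] by (simp add: h_def)
    have "tail_size L 1 \<le> tail_size \<mu> 1" "tail_size L 1 = h 1 - occ b J 1"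
      using t [of 1] K by (auto simp: h_def)
    then show "partition_sum q s K b n us L = D (h 1 - occ b J 1) * (\<Prod>x=1..K. ?A (h x - occ b J x))"
      using IH [OF L] tL by simp
  qed
  also have "\<dots> = (\<Sum>J\<in>Pow {1..K}. \<Prod>i\<le>K. f i (occ b J i) (occ b J (Suc i)))"
  proof (rule sum.cong [OF refl])
    fix J
    have K0: "{..K} = insert 0 {1..K}" by auto
    show "(\<Prod>i\<le>K. w i (occ b J i) (occ b J (Suc i))) *
      (D (h 1 - occ b J 1) * (\<Prod>x=1..K. ?A (h x - occ b J x))) =
      (\<Prod>i\<le>K. f i (occ b J i) (occ b J (Suc i)))"
      unfolding K0 by (simp add: f_def prod.distrib)
  qed
  also have "\<dots> = transfer b f (Suc K) 0" by (rule sum_bits_transfer_last [OF b])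
  finally have eq: "partition_sum q s K b n (us @ [u]) \<mu> = transfer b f (Suc K) 0" .
  have b01: "b = 0 \<or> b = 1" using b by auto
  have T0: "transfer b f 1 0 = t0" and T1: "transfer b f 1 1 = t1"
    using b01 by (auto simp: t0_def t1_def f_def w_def h_def)
  have fx: "f x j j' = ?A (h x - j) * vertex_weight q s (q ^ (N - 1) * v)
      (h x - h (Suc x) + j' - j) j (h x - h (Suc x)) j'" if "1 \<le> x" for x j j'
    using that hS [of x] by (simp add: f_def w_def u_def)
  have anti: "h (Suc x) \<le> h x" for x using hS [of x] by simp
  { assume "t0 = (1 - q ^ (N - tail_size \<mu> 1)) * z"
      and "0 < tail_size \<mu> 1 \<Longrightarrow>
        t1 = q ^ (N - tail_size \<mu> 1) * (q ^ (tail_size \<mu> 1 - 1) * v - s) * z"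
    then have "partition_sum q s K b n (us @ [u]) \<mu> =
        (1 - q ^ (N - h (Suc K))) * z * (\<Prod>y=1..<Suc K. ?A (h y))"
      using row_transfer [of N h s q v f b z "Suc K", OF N _ anti nz fx] hN T0 T1
      by (simp add: eq h_def del: transfer.simps)
    then show "partition_sum q s K b n (us @ [u]) \<mu> =
        (1 - q ^ N) * z * (\<Prod>x=1..K. ratio_prod q s v (tail_size \<mu> (int x)))"
      unfolding hK by (simp add: h_def atLeastLessThanSuc_atLeastAtMost) }
  { assume h1: "tail_size \<mu> 1 = 0"
    have h0: "h x = 0" if "1 \<le> x" for x
      using that by (induction x rule: nat_induct_at_least) (use h1 anti in \<open>auto simp: h_def le_zero_eq\<close>, metis le_zero_eq)
    have "1 - s * u \<noteq> 0" using nz [of "N - 1"] N by (simp add: u_def mult.assoc)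
    then have f1: "f x 0 0 = 1" "f x 1 0 = 0" if "1 \<le> x" for x
      using fx [OF that] h0 that by (auto simp: u_def ratio_prod_def vertex_weight_def)
    have "transfer b f (Suc x) 0 = transfer b f 1 0" for x
    proof (induction x)
      case (Suc x)
      then show ?case by (simp only: transfer.simps(2) [of b f "Suc x"] f1 [of "Suc x"]) simp
    qed simp
    then show "partition_sum q s K b n (us @ [u]) \<mu> = t0"
      using T0 by (simp add: eq) }
qed

section \<open>Closed forms for the two boundary conditions\<close>

lemma qpoch_Suc: "qpoch a p (Suc n) = qpoch a p n * (1 - a * p ^ n)"
  by (simp add: qpoch_def)

lemma qpoch_add: "qpoch a p (m + n) = qpoch a p m * (\<Prod>r=m..<m + n. 1 - a * p ^ r)"
  by (induction n) (auto simp: qpoch_Suc)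

lemma qpoch_split: "m \<le> n \<Longrightarrow> qpoch a p n = qpoch a p m * (\<Prod>r=m..<n. 1 - a * p ^ r)"
  using qpoch_add [of a p m "n - m"] by simp

lemma qpoch_nonzeroD: "qpoch a p n \<noteq> 0 \<Longrightarrow> i < n \<Longrightarrow> 1 - a * p ^ i \<noteq> 0"
  by (auto simp: qpoch_def)

lemma tail_size_zero:
  assumes "set_mset \<mu> \<subseteq> {0..int K}"
  shows "count \<mu> 0 + tail_size \<mu> 1 = size \<mu>"
proof -
  have "{#i \<in># \<mu>. 0 \<le> i#} = \<mu>"
    using assms by (auto simp: filter_mset_eq_conv)
  then show ?thesis using tail_size_count [of \<mu> 0] by (simp add: tail_size_def)
qed

text \<open>There are as many parts as rows, so column 0 holds exactly N - h_1 of them, with N =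
  \<open>Suc M\<close>. The vertex weights of column 0 thus already have the shape required at
  column 1, with z = \<open>?C / ?c\<close>.\<close>

lemma partition_sum_F:
  assumes "set_mset \<mu> \<subseteq> {0..int K}" "1 \<le> K" "size \<mu> = M" "qpoch (s * u) q M \<noteq> 0"
  shows "partition_sum q s K 1 0 (map (\<lambda>i. q ^ i * u) [0..<M]) \<mu> =
    qpoch q q M / qpoch (s * u) q M * (\<Prod>x=1..K. ratio_prod q s u (tail_size \<mu> (int x)))"
  using assms
proof (induction M arbitrary: \<mu>)
  case 0
  then show ?case by (simp add: partition_sum_Nil qpoch_def tail_size_def ratio_prod_def)
next
  case (Suc M)
  let ?C = "qpoch q q M / qpoch (s * u) q M" and ?c = "1 - s * (q ^ M * u)"
  have nz: "1 - s * q ^ i * u \<noteq> 0" if "i < Suc M" for i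
    using qpoch_nonzeroD [OF Suc.prems(4) that] by (simp add: ac_simps)
  have cnt: "count \<mu> 0 + tail_size \<mu> 1 = Suc M"
    using tail_size_zero [OF Suc.prems(1)] Suc.prems(3) by simp
  have "partition_sum q s K 1 0 (map (\<lambda>i. q ^ i * u) [0..<M] @ [q ^ (Suc M - 1) * u]) \<mu> =
    (1 - q ^ Suc M) * (?C / ?c) * (\<Prod>x=1..K. ratio_prod q s u (tail_size \<mu> (int x)))"
  proof (rule partition_sum_closed_snoc(2) [where D = "\<lambda>_. ?C"])
    show "partition_sum q s K 1 0 (map (\<lambda>i. q ^ i * u) [0..<M]) L =
        ?C * (\<Prod>x=1..K. ratio_prod q s u (tail_size L (int x)))"
      if "set_mset L \<subseteq> {0..int K}" "size L + 1 = size \<mu>" for L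
      using Suc.IH [of L] that Suc.prems by (simp add: qpoch_Suc)
    have "count \<mu> 0 = Suc M - tail_size \<mu> 1" using cnt by simp
    then show "vertex_weight q s (q ^ (Suc M - 1) * u) (count \<mu> 0 - 1) 1 (count \<mu> 0) 0 * ?C =
        (1 - q ^ (Suc M - tail_size \<mu> 1)) * (?C / ?c)"
      \<comment> \<open>If \<open>count \<mu> 0 = 0\<close>, the truncated \<open>0 - 1\<close>
        gives a vertex of weight 0, in agreement with \<open>1 - q ^ 0\<close>.\<close>
      by (cases "count \<mu> 0") (auto simp: vertex_weight_def)
    assume "0 < tail_size \<mu> 1"
    then have "M = (Suc M - tail_size \<mu> 1) + (tail_size \<mu> 1 - 1)" using cnt by simp
    then have "q ^ M = q ^ (Suc M - tail_size \<mu> 1) * q ^ (tail_size \<mu> 1 - 1)"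
      by (metis power_add)
    then have "q ^ M * u - s * q ^ (Suc M - tail_size \<mu> 1) =
        q ^ (Suc M - tail_size \<mu> 1) * (q ^ (tail_size \<mu> 1 - 1) * u - s)"
      by (simp add: algebra_simps)
    then show "vertex_weight q s (q ^ (Suc M - 1) * u) (count \<mu> 0 + 1 - 1) 1 (count \<mu> 0) 1 * ?C =
        q ^ (Suc M - tail_size \<mu> 1) * (q ^ (tail_size \<mu> 1 - 1) * u - s) * (?C / ?c)"
      using \<open>count \<mu> 0 = Suc M - tail_size \<mu> 1\<close>
      by (simp add: vertex_weight_def)
  qed (use Suc.prems nz cnt in auto)
  then show ?case
    by (simp add: qpoch_Suc mult.assoc) (simp add: mult.left_commute)
qed

text \<open>The coefficient in the formula for \<^const>\<open>G\<close> with the quotients of \<^const>\<open>qpoch\<close>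
  cancelled, since the induction passes through parameters at which the denominators may vanish.
  The truncated exponent \<open>N - i\<close> makes it \<open>0\<close> for \<open>N < l\<close>, as it should be.\<close>

definition G_coeff :: "complex \<Rightarrow> complex \<Rightarrow> complex \<Rightarrow> nat \<Rightarrow> nat \<Rightarrow> nat \<Rightarrow> complex" where
  "G_coeff q s v n N l = (\<Prod>i<l. 1 - q ^ (N - i)) * (\<Prod>r=n - l..<n. 1 - s\<^sup>2 * q ^ r) *
     (\<Prod>r=n..<N + n - l. 1 - s * v * q ^ r) / (qpoch (s * v) q N * qpoch (s * inverse v) (inverse q) l)"

lemma G_coeff_eq_0: "N < l \<Longrightarrow> G_coeff q s v n N l = 0"
proof -
  assume "N < l"
  then have "(\<Prod>i<l. 1 - q ^ (N - i)) = 0"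
    by (intro prod_zero) (auto intro: bexI [of _ N])
  then show ?thesis by (simp add: G_coeff_def)
qed

text \<open>With no path entering from the left, each row can carry at most one path out of column
  0, so \<open>N\<close> rows produce at most \<open>N\<close> nonzero parts. The statement includes
  signatures with more of them, where both sides vanish, because the step to \<open>Suc N\<close>
  rows meets such boundaries below its top row.\<close>

lemma partition_sum_G:
  fixes q s v :: complex
  assumes q: "q \<noteq> 0" and "set_mset \<mu> \<subseteq> {0..int K}" "1 \<le> K" "size \<mu> = n" "qpoch (s * v) q N \<noteq> 0"
    and "0 < tail_size \<mu> 1 \<Longrightarrow> v \<noteq> 0" "qpoch (s * inverse v) (inverse q) (tail_size \<mu> 1) \<noteq> 0"
  shows "partition_sum q s K 0 n (map (\<lambda>i. q ^ i * v) [0..<N]) \<mu> =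
    G_coeff q s v n N (tail_size \<mu> 1) * (\<Prod>x=1..K. ratio_prod q s v (tail_size \<mu> (int x)))"
  using assms(2-)
proof (induction N arbitrary: \<mu>)
  case 0
  have tl: "count \<mu> 0 + tail_size \<mu> 1 = n"
    using tail_size_zero [OF 0(1)] 0(3) by simp
  show ?case
  proof (cases "tail_size \<mu> 1 = 0")
    case True
    then have "count \<mu> 0 = size \<mu>" using tl 0(3) by simp
    then have "\<mu> = replicate_mset n 0"
      by (metis 0(3) count_le_replicate_mset_subset_eq le_refl size_replicate_mset
          mset_subset_size subset_mset.le_less less_irrefl)
    moreover have "tail_size \<mu> (int x) = 0" if "1 \<le> x" for x
      using that \<open>\<mu> = replicate_mset n 0\<close> by (cases n) (auto simp: tail_size_def)
    ultimately show ?thesis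
      using True by (simp add: partition_sum_Nil G_coeff_def qpoch_def ratio_prod_def)
  next
    case False
    moreover have "tail_size (replicate_mset n 0) 1 = 0"
      by (induction n) (auto simp: tail_size_def)
    ultimately have "\<mu> \<noteq> replicate_mset n 0" by auto
    then show ?thesis using False by (simp add: partition_sum_Nil G_coeff_eq_0)
  qed
next
  case (Suc N)
  define l where "l = tail_size \<mu> 1"
  let ?us = "map (\<lambda>i. q ^ i * v) [0..<N]" and ?c = "1 - s * (q ^ N * v)"
  let ?D = "G_coeff q s v n N"
  have nz: "1 - s * q ^ i * v \<noteq> 0" if "i < Suc N" for i
    using qpoch_nonzeroD [OF Suc.prems(4) that] by (simp add: ac_simps)
  have c: "?c \<noteq> 0" using nz [of N] by (simp add: mult.assoc)
  have tl: "count \<mu> 0 + l = n"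
    using tail_size_zero [OF Suc.prems(1)] Suc.prems(3) by (simp add: l_def)
  then have k: "count \<mu> 0 = n - l" by simp
  have IH: "partition_sum q s K 0 n ?us L =
      ?D (tail_size L 1) * (\<Prod>x=1..K. ratio_prod q s v (tail_size L (int x)))"
    if L: "set_mset L \<subseteq> {0..int K}" "size L + 0 = size \<mu>" "tail_size L 1 \<le> tail_size \<mu> 1" for L
  proof (rule Suc.IH)
    \<comment> \<open>A row never decreases the number of nonzero parts, so this product divides the
      one for \<open>\<mu>\<close>.\<close>
    show "qpoch (s * inverse v) (inverse q) (tail_size L 1) \<noteq> 0"
      using qpoch_split [OF L(3), of "s * inverse v" "inverse q"] Suc.prems(6) by auto
  qed (use L Suc.prems in \<open>auto simp: qpoch_Suc\<close>)
  have us: "map (\<lambda>i. q ^ i * v) [0..<Suc N] = ?us @ [q ^ (Suc N - 1) * v]" by simp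
  consider "l = 0" | "0 < l" "l \<le> Suc N" | "Suc N < l" by linarith
  then show ?case
  proof cases
    case 1
    have "tail_size \<mu> (int x) = 0" if "1 \<le> x" for x
      using that
    proof (induction x rule: nat_induct_at_least)
      case (Suc x)
      then show ?case using tail_size_count [of \<mu> "int x"] by (simp add: add.commute)
    qed (use 1 in \<open>simp add: l_def\<close>)
    then have P: "(\<Prod>x=1..K. ratio_prod q s v (tail_size \<mu> (int x))) = 1"
      by (simp add: ratio_prod_def)
    have "partition_sum q s K 0 n (?us @ [q ^ (Suc N - 1) * v]) \<mu> =
        vertex_weight q s (q ^ (Suc N - 1) * v) (count \<mu> 0 - 0) 0 (count \<mu> 0) 0 * ?D (tail_size \<mu> 1)"
      by (rule partition_sum_closed_snoc(1) [OF _ Suc.prems(1,2) _ _ nz IH])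
        (use 1 in \<open>auto simp: l_def\<close>)
    also have "\<dots> = G_coeff q s v n (Suc N) (tail_size \<mu> 1)"
      using 1 tl c by (simp add: vertex_weight_def l_def G_coeff_def qpoch_Suc power_add ac_simps)
    finally show ?thesis unfolding us P by simp
  next
    case 2
    then obtain l' where l': "l = Suc l'" by (cases l) auto
    define R where "R = qpoch (s * inverse v) (inverse q) l'"
    define S where "S = (\<Prod>r=Suc (n - l)..<n. 1 - s\<^sup>2 * q ^ r)"
    define T where "T = (\<Prod>r=n..<N + n - l'. 1 - s * v * q ^ r)"
    define U where "U = (\<Prod>i<l'. 1 - q ^ (N - i))"
    define d where "d = 1 - s * inverse v * inverse q ^ l'"
    define e where "e = 1 - s\<^sup>2 * q ^ (n - l)"
    define V where "V = qpoch (s * v) q N"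
    \<comment> \<open>The target coefficient for \<open>Suc N\<close> rows without its factor
      \<open>1 - q ^ Suc N\<close>, so that no division by this factor occurs.\<close>
    define z where "z = U * (e * S) * T / (V * ?c * (R * d))"
    have v: "v \<noteq> 0" using Suc.prems(5) 2 by (simp add: l_def)
    have Rd: "R * d \<noteq> 0" using Suc.prems(6) by (simp add: l_def [symmetric] l' qpoch_Suc R_def d_def)
    have V: "V \<noteq> 0" using Suc.prems(4) by (simp add: qpoch_Suc V_def)
    have ln: "l \<le> n" using tl by simp
    have Se: "(\<Prod>r=n - l..<n. 1 - s\<^sup>2 * q ^ r) = e * S"
      unfolding S_def e_def using ln 2 by (subst prod.atLeast_Suc_lessThan) auto
    have Dl': "?D (l - 1) = U * S * T / (V * R)"
      using ln by (simp add: G_coeff_def l' U_def S_def T_def V_def R_def Suc_diff_Suc)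
    have D1: "G_coeff q s v n (Suc N) l = (1 - q ^ Suc N) * z"
    proof -
      have U1: "(\<Prod>i<l. 1 - q ^ (Suc N - i)) = (1 - q ^ Suc N) * U"
        unfolding l' U_def by (subst prod.lessThan_Suc_shift) simp
      show ?thesis
        unfolding G_coeff_def Se U1 z_def
        by (simp add: l' T_def R_def d_def V_def qpoch_Suc ac_simps)
    qed
    have t0: "(1 - s * q ^ (n - l) * (q ^ N * v)) / ?c * ?D l = (1 - q ^ (Suc N - l)) * z"
    proof (cases "l = Suc N")
      \<comment> \<open>A new nonzero part must be created in this row: \<open>?D l\<close>
        vanishes, and so does \<open>1 - q ^ 0\<close> on the right.\<close>
      case True
      then show ?thesis by (simp add: G_coeff_eq_0)
    next
      case False
      then have lN: "l \<le> N" using 2 by simp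
      have U0: "(\<Prod>i<l. 1 - q ^ (N - i)) = U * (1 - q ^ (Suc N - l))"
        by (simp add: l' U_def)
      have T0: "T = (\<Prod>r=n..<N + n - l. 1 - s * v * q ^ r) * (1 - s * q ^ (n - l) * (q ^ N * v))"
      proof -
        have "N + n - l' = Suc (N + n - l)" "n \<le> N + n - l" using lN l' by auto
        moreover have "q ^ (N + n - l) = q ^ (n - l) * q ^ N" using ln by (simp add: add.commute [of n] flip: power_add)
        ultimately show ?thesis by (simp add: T_def ac_simps)
      qed
      have Rl: "qpoch (s * inverse v) (inverse q) l = R * d"
        by (simp add: l' R_def d_def qpoch_Suc)
      show ?thesis
        unfolding G_coeff_def Se U0 T0 z_def Rl V_def [symmetric] by (simp add: ac_simps)
    qed
    have t1: "(e * (q ^ N * v)) / ?c * ?D (l - 1) = q ^ (Suc N - l) * (q ^ (l - 1) * v - s) * z"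
    proof -
      have "N = (Suc N - l) + l'" using 2 l' by simp
      then have "q ^ N = q ^ (Suc N - l) * q ^ l'" by (metis power_add)
      \<comment> \<open>Origin of the Pochhammer symbol in 1/q: its new factor \<open>d\<close>, in
        the denominator of \<open>z\<close>, cancels against the factor
        \<open>q ^ (l - 1) * v - s\<close> demanded by the vector at column 1.\<close>
      moreover have "q ^ l' * v - s = q ^ l' * v * d"
        using v q by (simp add: d_def field_simps)
      ultimately show ?thesis
        using c Rd V unfolding Dl' z_def by (simp add: l' divide_simps)
    qed
    have "partition_sum q s K 0 n (?us @ [q ^ (Suc N - 1) * v]) \<mu> =
      (1 - q ^ Suc N) * z * (\<Prod>x=1..K. ratio_prod q s v (tail_size \<mu> (int x)))"
    proof (rule partition_sum_closed_snoc(2) [OF _ Suc.prems(1,2) _ _ nz IH])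
      show "vertex_weight q s (q ^ (Suc N - 1) * v) (count \<mu> 0 - 0) 0 (count \<mu> 0) 0 *
          ?D (tail_size \<mu> 1) = (1 - q ^ (Suc N - tail_size \<mu> 1)) * z"
        using t0 by (simp add: vertex_weight_def k l_def)
      show "vertex_weight q s (q ^ (Suc N - 1) * v) (count \<mu> 0 + 1 - 0) 0 (count \<mu> 0) 1 *
          ?D (tail_size \<mu> 1 - 1) =
          q ^ (Suc N - tail_size \<mu> 1) * (q ^ (tail_size \<mu> 1 - 1) * v - s) * z"
        using t1 by (simp add: vertex_weight_def k l_def e_def)
    qed (use 2 in \<open>auto simp: l_def\<close>)
    then show ?thesis unfolding us using D1 by (simp add: l_def)
  next
    case 3
    \<comment> \<open>One row lowers the number of nonzero parts by at most one, so every possible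
      \<open>L\<close> still has more than \<open>N\<close> of them.\<close>
    have zero: "partition_sum q s K 0 n ?us L = 0"
      if "set_mset L \<subseteq> {0..int K}" "size L + 0 = size \<mu>"
        "occ 0 J 1 + tail_size L 1 = tail_size \<mu> 1" for J L
    proof -
      have "N < tail_size L 1" "tail_size L 1 \<le> tail_size \<mu> 1"
        using that(3) 3 by (auto simp: l_def occ_def split: if_splits)
      then show ?thesis using IH [OF that(1,2)] by (simp add: G_coeff_eq_0)
    qed
    have "partition_sum q s K 0 n (?us @ [q ^ (Suc N - 1) * v]) \<mu> = 0"
    proof (subst partition_sum_bits [where g = "\<lambda>_. 0"])
      fix J L assume "set_mset L \<subseteq> {0..int K}" "size L + 0 = size \<mu>"
        and occ: "\<And>x. x \<in> {1..K} \<Longrightarrow> occ 0 J x + tail_size L (int x) = tail_size \<mu> (int x)"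
      moreover have "occ 0 J 1 + tail_size L 1 = tail_size \<mu> 1"
        using occ [of 1] Suc.prems(2) by simp
      ultimately show "partition_sum q s K 0 n ?us L = 0" using zero by blast
    qed (use Suc.prems(1) in simp_all)
    then show ?thesis unfolding us using 3 by (simp add: G_coeff_eq_0 l_def)
  qed
qed

section \<open>From multisets of columns back to signatures\<close>

lemma sorted_nth_ge_iff:
  "sorted_wrt (\<ge>) \<mu> \<Longrightarrow> i < length \<mu> \<Longrightarrow> (x::int) \<le> \<mu> ! i \<longleftrightarrow> i < tail_size (mset \<mu>) x"
proof (induction \<mu> arbitrary: i)
  case (Cons y \<mu>)
  show ?case
  proof (cases "x \<le> y")
    case True
    with Cons show ?thesis by (cases i) (auto simp: tail_size_def)
  next
    case False
    have "\<forall>z\<in>set (y # \<mu>). \<not> x \<le> z" using Cons.prems(1) False by auto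
    moreover from this have "tail_size (mset (y # \<mu>)) x = 0"
      by (auto simp: tail_size_def filter_mset_eq_conv)
    ultimately show ?thesis using nth_mem [OF Cons.prems(2)] by auto
  qed
qed simp

text \<open>Both sides multiply \<open>a i\<close> over the cells (i, x) of the Young diagram of
  \<open>\<mu>\<close>, by rows on the left and by columns on the right. The two versions agree
  because zero parts contribute empty rows.\<close>

lemma prod_ratio_prod:
  fixes a :: "nat \<Rightarrow> complex"
  assumes \<mu>: "sorted_wrt (\<ge>) \<mu>" "set \<mu> \<subseteq> {0..int K}"
  shows "(\<Prod>i<tail_size (mset \<mu>) 1. a i powi (\<mu> ! i)) =
      (\<Prod>x=1..K. \<Prod>i<tail_size (mset \<mu>) (int x). a i)"
    and "(\<Prod>i<length \<mu>. a i powi (\<mu> ! i)) =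
      (\<Prod>x=1..K. \<Prod>i<tail_size (mset \<mu>) (int x). a i)"
proof -
  let ?t = "\<lambda>x. tail_size (mset \<mu>) x"
  have t_le: "?t x \<le> length \<mu>" for x
    unfolding tail_size_def by (metis size_filter_mset_lesseq size_mset)
  have "(\<Prod>i<length \<mu>. a i powi (\<mu> ! i)) = (\<Prod>i<length \<mu>. \<Prod>x=1..K. if int x \<le> \<mu> ! i then a i else 1)"
  proof (rule prod.cong [OF refl])
    fix i assume "i \<in> {..<length \<mu>}"
    then have "\<mu> ! i \<in> {0..int K}" using \<mu>(2) nth_mem by blast
    then obtain m where m: "\<mu> ! i = int m" "m \<le> K"
      using that [of "nat (\<mu> ! i)"] by auto
    have "(\<Prod>x=1..K. if int x \<le> \<mu> ! i then a i else 1) = (\<Prod>x\<in>{x\<in>{1..K}. x \<le> m}. a i)"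
      unfolding m of_nat_le_iff by (rule prod.inter_filter [symmetric]) simp
    also have "{x\<in>{1..K}. x \<le> m} = {1..m}" using m by auto
    finally show "a i powi (\<mu> ! i) = (\<Prod>x=1..K. if int x \<le> \<mu> ! i then a i else 1)"
      by (simp add: m)
  qed
  also have "\<dots> = (\<Prod>x=1..K. \<Prod>i<length \<mu>. if int x \<le> \<mu> ! i then a i else 1)"
    by (rule prod.swap)
  also have "\<dots> = (\<Prod>x=1..K. \<Prod>i<?t (int x). a i)"
  proof (rule prod.cong [OF refl])
    fix x
    have "{i \<in> {..<length \<mu>}. int x \<le> \<mu> ! i} = {..<?t (int x)}"
      using sorted_nth_ge_iff [OF \<mu>(1)] t_le [of "int x"] by auto
    then show "(\<Prod>i<length \<mu>. if int x \<le> \<mu> ! i then a i else 1) = (\<Prod>i<?t (int x). a i)"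
      by (simp add: prod.inter_filter [symmetric])
  qed
  finally show 2: "(\<Prod>i<length \<mu>. a i powi (\<mu> ! i)) = (\<Prod>x=1..K. \<Prod>i<?t (int x). a i)" .
  have "(\<Prod>i<?t 1. a i powi (\<mu> ! i)) = (\<Prod>i<length \<mu>. a i powi (\<mu> ! i))"
  proof (rule prod.mono_neutral_left)
    show "\<forall>i\<in>{..<length \<mu>} - {..<?t 1}. a i powi (\<mu> ! i) = 1"
    proof
      fix i assume i: "i \<in> {..<length \<mu>} - {..<?t 1}"
      then have "\<not> 1 \<le> \<mu> ! i" using sorted_nth_ge_iff [OF \<mu>(1)] by auto
      moreover have "\<mu> ! i \<in> {0..int K}" using \<mu>(2) nth_mem i by blast
      ultimately have "\<mu> ! i = 0" by auto
      then show "a i powi (\<mu> ! i) = 1" by simp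
    qed
  qed (use t_le in auto)
  with 2 show "(\<Prod>i<?t 1. a i powi (\<mu> ! i)) = (\<Prod>x=1..K. \<Prod>i<?t (int x). a i)" by simp
qed

lemma Sign_nonneg_bounded:
  assumes "\<mu> \<in> Sign_nonneg M"
  obtains K where "1 \<le> K" "set \<mu> \<subseteq> {0..int K}" "length \<mu> = M" "sorted_wrt (\<ge>) \<mu>"
proof
  \<comment> \<open>Inserting 0 covers the empty signature, and \<open>Suc\<close> ensures that
    column 1 exists.\<close>
  let ?K = "Suc (nat (Max (insert 0 (set \<mu>))))"
  show "set \<mu> \<subseteq> {0..int ?K}"
  proof
    fix x assume x: "x \<in> set \<mu>"
    then have "x \<le> Max (insert 0 (set \<mu>))" by simp
    then have "x \<le> int ?K" by linarith
    with x assms show "x \<in> {0..int ?K}" by (auto simp: Sign_nonneg_def)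
  qed
qed (use assms in \<open>auto simp: Sign_nonneg_def Sign_def\<close>)

lemma geometric_nonzero:
  fixes q s u :: complex
  assumes "qpoch (s * u) q M \<noteq> 0"
  shows "\<forall>w\<in>set (map (\<lambda>i. q ^ i * u) [0..<M]). 1 - s * w \<noteq> 0"
proof
  fix w assume "w \<in> set (map (\<lambda>i. q ^ i * u) [0..<M])"
  then obtain i where "i < M" "w = q ^ i * u" by auto
  with qpoch_nonzeroD [OF assms, of i] show "1 - s * w \<noteq> 0" by (simp add: ac_simps)
qed

lemma F_eq:
  assumes \<mu>: "\<mu> \<in> Sign_nonneg M" and nz: "qpoch (s * u) q M \<noteq> 0"
  shows "F q s \<mu> (map (\<lambda>i. q ^ i * u) [0..<M]) =
    qpoch q q M / qpoch (s * u) q M *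
    (\<Prod>i=1..M. ((q ^ (i - 1) * u - s) / (1 - s * q ^ (i - 1) * u)) powi (\<mu> ! (i - 1)))"
proof -
  let ?us = "map (\<lambda>i. q ^ i * u) [0..<M]"
  obtain K where K: "1 \<le> K" "set \<mu> \<subseteq> {0..int K}" "length \<mu> = M" "sorted_wrt (\<ge>) \<mu>"
    using Sign_nonneg_bounded [OF \<mu>] .
  have "F q s \<mu> ?us = path_sum q s ?us (start_edges 1 0 (length ?us)) (vert (int (length ?us)) (mset \<mu>))"
    by (simp add: F_def Let_def start_edges_def vert_def)
  also have "\<dots> = partition_sum q s K 1 0 ?us (mset \<mu>)"
    unfolding partition_sum_def using K by (intro path_sum_flows geometric_nonzero [OF nz]) simp
  also have "\<dots> = qpoch q q M / qpoch (s * u) q M *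
      (\<Prod>x=1..K. ratio_prod q s u (tail_size (mset \<mu>) (int x)))"
    using K nz by (intro partition_sum_F) auto
  also have "(\<Prod>x=1..K. ratio_prod q s u (tail_size (mset \<mu>) (int x))) =
      (\<Prod>i<M. ((q ^ i * u - s) / (1 - s * q ^ i * u)) powi (\<mu> ! i))"
    unfolding ratio_prod_def using prod_ratio_prod(2) [OF K(4,2)] K(3) by simp
  finally show ?thesis
    by (simp add: prod.atLeast1_atMost_eq)
qed

lemma G_eq:
  fixes q s v :: complex
  assumes q: "q \<noteq> 0" and \<nu>: "\<nu> \<in> Sign_nonneg n" and k: "k = count_list \<nu> 0" and N: "n - k \<le> N"
    and v: "k < n \<longrightarrow> v \<noteq> 0"
    and nz: "qpoch q q (N - (n - k)) \<noteq> 0" "qpoch (s\<^sup>2) q k \<noteq> 0" "qpoch (s * v) q n \<noteq> 0"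
      "qpoch (s * v) q N \<noteq> 0" "qpoch (s * inverse v) (inverse q) (n - k) \<noteq> 0"
  shows "G q s \<nu> (map (\<lambda>i. q ^ i * v) [0..<N]) =
     (qpoch q q N * qpoch (s\<^sup>2) q n * qpoch (s * v) q (N + k)) /
     (qpoch q q (N - (n - k)) * qpoch (s\<^sup>2) q k * qpoch (s * v) q n * qpoch (s * v) q N *
      qpoch (s * inverse v) (inverse q) (n - k)) *
     (\<Prod>i=1..n - k. ((q ^ (i - 1) * v - s) / (1 - s * q ^ (i - 1) * v)) powi (\<nu> ! (i - 1)))"
proof -
  let ?us = "map (\<lambda>i. q ^ i * v) [0..<N]"
  obtain K where K: "1 \<le> K" "set \<nu> \<subseteq> {0..int K}" "length \<nu> = n" "sorted_wrt (\<ge>) \<nu>"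
    using Sign_nonneg_bounded [OF \<nu>] .
  have "count (mset \<nu>) 0 + tail_size (mset \<nu>) 1 = n"
    using tail_size_zero [of "mset \<nu>" K] K by simp
  then have tl: "tail_size (mset \<nu>) 1 = n - k" and kn: "k \<le> n"
    by (auto simp: k count_mset)
  have "G q s \<nu> ?us = path_sum q s ?us (start_edges 0 n (length ?us)) (vert (int (length ?us)) (mset \<nu>))"
    by (simp add: G_def Let_def start_edges_def vert_def K(3))
  also have "\<dots> = partition_sum q s K 0 n ?us (mset \<nu>)"
    unfolding partition_sum_def using K by (intro path_sum_flows geometric_nonzero [OF nz(4)]) simp
  also have "\<dots> = G_coeff q s v n N (n - k) *
      (\<Prod>x=1..K. ratio_prod q s v (tail_size (mset \<nu>) (int x)))"
    using K nz v q by (subst partition_sum_G) (auto simp: tl)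
  also have "(\<Prod>x=1..K. ratio_prod q s v (tail_size (mset \<nu>) (int x))) =
      (\<Prod>i<n - k. ((q ^ i * v - s) / (1 - s * q ^ i * v)) powi (\<nu> ! i))"
    unfolding ratio_prod_def using prod_ratio_prod(1) [OF K(4,2)] tl by simp
  also have "G_coeff q s v n N (n - k) =
     (qpoch q q N * qpoch (s\<^sup>2) q n * qpoch (s * v) q (N + k)) /
     (qpoch q q (N - (n - k)) * qpoch (s\<^sup>2) q k * qpoch (s * v) q n * qpoch (s * v) q N *
      qpoch (s * inverse v) (inverse q) (n - k))"
  proof -
    have "qpoch q q N = qpoch q q (N - (n - k)) * (\<Prod>r=N - (n - k)..<N. 1 - q * q ^ r)"
      by (rule qpoch_split) simp
    \<comment> \<open>The factors are listed backwards, with i = N - 1 - r.\<close>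
    also have "(\<Prod>r=N - (n - k)..<N. 1 - q * q ^ r) = (\<Prod>i<n - k. 1 - q ^ (N - i))"
      by (rule prod.reindex_bij_witness [of _ "\<lambda>i. N - 1 - i" "\<lambda>r. N - 1 - r"])
        (use N in \<open>auto simp flip: power_Suc\<close>)
    finally have 1: "qpoch q q N = qpoch q q (N - (n - k)) * (\<Prod>i<n - k. 1 - q ^ (N - i))" .
    have 2: "qpoch (s\<^sup>2) q n = qpoch (s\<^sup>2) q k * (\<Prod>r=n - (n - k)..<n. 1 - s\<^sup>2 * q ^ r)"
      using qpoch_split [OF kn] kn by simp
    have 3: "qpoch (s * v) q (N + k) = qpoch (s * v) q n * (\<Prod>r=n..<N + n - (n - k). 1 - s * v * q ^ r)"
    proof -
      have "N + n - (n - k) = N + k" using kn by simp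
      then show ?thesis using qpoch_split [of n "N + k" "s * v" q] N by simp
    qed
    show ?thesis
      unfolding G_coeff_def 1 2 3 using nz by simp
  qed
  finally show ?thesis
    by (simp add: prod.atLeast1_atMost_eq)
qed

theorem proposition6p1:
  fixes q s :: complex
  assumes "q \<noteq> 0"
  shows
    "(\<forall>M. \<forall>\<mu> \<in> Sign_nonneg M. \<forall>u.
        qpoch (s * u) q M \<noteq> 0 \<longrightarrow>
        F q s \<mu> (map (\<lambda>i. q ^ i * u) [0..<M]) =
          qpoch q q M / qpoch (s * u) q M *
          (\<Prod>i=1..M. ((q ^ (i - 1) * u - s) / (1 - s * q ^ (i - 1) * u)) powi (\<mu> ! (i - 1))))
     \<and>
     (\<forall>n. \<forall>\<nu> \<in> Sign_nonneg n. \<forall>k. k = count_list \<nu> 0 \<longrightarrow>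
        (\<forall>N \<ge> n - k. \<forall>v.
           (k < n \<longrightarrow> v \<noteq> 0) \<longrightarrow>
           qpoch q q (N - (n - k)) \<noteq> 0 \<longrightarrow>
           qpoch (s\<^sup>2) q k \<noteq> 0 \<longrightarrow>
           qpoch (s * v) q n \<noteq> 0 \<longrightarrow>
           qpoch (s * v) q N \<noteq> 0 \<longrightarrow>
           qpoch (s * inverse v) (inverse q) (n - k) \<noteq> 0 \<longrightarrow>
           G q s \<nu> (map (\<lambda>i. q ^ i * v) [0..<N]) =
             (qpoch q q N * qpoch (s\<^sup>2) q n * qpoch (s * v) q (N + k)) /
             (qpoch q q (N - (n - k)) * qpoch (s\<^sup>2) q k * qpoch (s * v) q n * qpoch (s * v) q N *
              qpoch (s * inverse v) (inverse q) (n - k)) *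
             (\<Prod>i=1..n - k. ((q ^ (i - 1) * v - s) / (1 - s * q ^ (i - 1) * v)) powi (\<nu> ! (i - 1)))))"
  using F_eq G_eq [OF assms] by blast

end
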